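(* Let $q > 2$ be an even prime power and let $L = (\mathcal P, \mathcal B)$ be an ovoidal Laguerre plane of order $q$. Let $\mathcal F \subseteq \mathcal B$ be an intersecting family. Then $|\mathcal F| \leq q^2$. Equality occurs if and only if one of the following holds: $\mathcal F$ consists of all circles through a point of $\mathcal P$ (i.e. $\mathcal F = \{c \in \mathcal B : P \in c\}$ for some $P \in \mathcal P$), or $\mathcal F$ consists of a circle $c \in \mathcal B$ and all circles intersecting $c$ in exactly one point (i.e. $\mathcal F = \{c\} \cup \{c' \in \mathcal B : |c \cap c'| = 1\}$ for some $c \in \mathcal B$).
   Context: $\mathrm{PG}(n,q)$ is the projective space of (projective) dimension $n$ over $\mathbb F_q$. An oval in a projective plane $\mathrm{PG}(2,q)$ is a set of $q+1$ points, no three collinear. An oval cone in $\mathrm{PG}(3,q)$ is a set $\mathcal Q = \bigcup_{P \in \mathcal O} \langle R,P \rangle$, where $\mathcal O$ is an oval in some plane $\pi$ of $\mathrm{PG}(3,q)$, $R$ is a point not in $\pi$ (the vertex), and $\langle R,P\rangle$ is the line through $R$ and $P$. The planes of $\mathrm{PG}(3,q)$ meeting $\mathcal Q$ in an oval (the oval planes) are exactly the planes not containing $R$. An ovoidal Laguerre plane of order $q$ is an incidence structure (isomorphic to one) $(\mathcal P,\mathcal B)$ obtained from an oval cone $\mathcal Q$ in $\mathrm{PG}(3,q)$ as follows: $\mathcal P = \mathcal Q \setminus \{R\}$, and the elements of $\mathcal B$, called circles, are the sets $\pi \cap \mathcal Q$ with $\pi$ a plane of $\mathrm{PG}(3,q)$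 not containing $R$. A family $\mathcal F \subseteq \mathcal B$ is intersecting if any two of its members have at least one point in common. *)

theory Defs
  imports "HOL-Analysis.Cartesian_Space" "HOL-Library.Numeral_Type"
begin

text \<open>
  A point of the projective space on a vector space over a field is a 1-dimensional linear
  subspace. Lines and planes are identified with the sets of points they contain; the one coming
  from the linear subspace \<open>U\<close> is \<open>pg_points U\<close>, and its projective dimension is one less than the
  linear dimension of \<open>U\<close>. The field of order \<open>q\<close> is a finite type of class \<open>field\<close> with \<open>q\<close>
  elements, and \<open>PG(3,q)\<close> is the projective space on its fourth power.
\<close>

definition pg_points :: "('k::field ^ 'n) set \<Rightarrow> ('k ^ 'n) set set" where
  "pg_points U = {X. vec.subspace X \<and> vec.dim X = 1 \<and> X \<subseteq> U}"

definition pg_lines :: "('k::field ^ 'n) set set set" where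
  "pg_lines = {pg_points U | U. vec.subspace U \<and> vec.dim U = 2}"

definition pg_planes :: "('k::field ^ 'n) set set set" where
  "pg_planes = {pg_points U | U. vec.subspace U \<and> vec.dim U = 3}"

definition pg_join :: "('k::field ^ 'n) set \<Rightarrow> ('k ^ 'n) set \<Rightarrow> ('k ^ 'n) set set" where
  "pg_join X Y = pg_points (vec.span (X \<union> Y))"

definition pg_collinear :: "('k::field ^ 'n) set set \<Rightarrow> bool" where
  "pg_collinear S \<longleftrightarrow> (\<exists>l\<in>pg_lines. S \<subseteq> l)"

definition oval_in :: "('k::{field,finite} ^ 'n) set set \<Rightarrow> ('k ^ 'n) set set \<Rightarrow> bool" where
  "oval_in \<pi> S \<longleftrightarrow> S \<subseteq> \<pi> \<and> card S = CARD('k) + 1 \<and>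
     (\<forall>X\<in>S. \<forall>Y\<in>S. \<forall>Z\<in>S. X \<noteq> Y \<and> X \<noteq> Z \<and> Y \<noteq> Z \<longrightarrow> \<not> pg_collinear {X, Y, Z})"

definition oval_cone :: "('k::{field,finite} ^ 4) set \<Rightarrow> ('k ^ 4) set set \<Rightarrow> bool" where
  "oval_cone R Q \<longleftrightarrow>
     (\<exists>\<pi>\<in>pg_planes. \<exists>S. oval_in \<pi> S \<and> R \<in> pg_points UNIV \<and> R \<notin> \<pi> \<and> Q = (\<Union>X\<in>S. pg_join R X))"

definition cone_circles :: "('k::field ^ 4) set \<Rightarrow> ('k ^ 4) set set \<Rightarrow> ('k ^ 4) set set set" where
  "cone_circles R Q = {\<pi> \<inter> Q | \<pi>. \<pi> \<in> pg_planes \<and> R \<notin> \<pi>}"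

text \<open>
  Circles are sets of points, so an isomorphism is a bijection \<open>f\<close> of the points carrying the set of
  circles onto the set of circles. The order is the number of elements of the field \<open>'k\<close>.
\<close>

definition ovoidal_laguerre_plane ::
    "'k::{field,finite} itself \<Rightarrow> 'p set \<Rightarrow> 'p set set \<Rightarrow> bool" where
  "ovoidal_laguerre_plane _ P B \<longleftrightarrow> B \<subseteq> Pow P \<and>
     (\<exists>(R :: ('k ^ 4) set) Q f. oval_cone R Q \<and> bij_betw f P (Q - {R}) \<and>
        (\<lambda>c. f ` c) ` B = cone_circles R Q)"

definition intersecting_family :: "'p set set \<Rightarrow> bool" where
  "intersecting_family F \<longleftrightarrow> pairwise (\<lambda>c d. c \<inter> d \<noteq> {}) F"

end

theory Submission
  imports Defs
begin

text \<open>
  Parametrise the points on each of the \<open>q + 1\<close> generators of the cone by the field. A circle then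
  becomes a word with one letter per generator, two circles meet where their words agree, and three
  letters in different columns determine the word (\<open>cone_coordinates\<close>). The problem becomes one about
  words that pairwise agree in some column.

  Because \<open>q\<close> is even, touching is an equivalence relation (\<open>touches_trans\<close>), and its classes
  serve as the letters of an additional column (\<open>touching_classes_form_column\<close>). In the extended array
  two different words agree in no column or in exactly two, and the two extremal kinds of families
  become a single kind: all words with a given letter in a given column, old or new. An intersecting
  family \<open>F\<close> remains intersecting.

  The weight of a word \<open>c\<close> counts how often its letters occur in \<open>F\<close>, and this equals the number of
  agreements of \<open>c\<close> with members of \<open>F\<close>. It is therefore constant on \<open>F\<close>, and the variance of its
  difference to a multiple of the indicator function of \<open>F\<close> can be computed
  (\<open>variance_identity\<close>). That the variance is nonnegative is the bound \<open>card F \<le> q\<^sup>2\<close>. In the case of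
  equality the variance vanishes and the weights of all words are known. Counting along lines and fibres of
  the array shows that a letter occurs at most \<open>q\<close> or at least \<open>q\<^sup>2 - q\<close> times
  (\<open>occurrences_dichotomy\<close>). The known weight of a member forces one of its letters to be of the
  second kind, and then to occur in all members (\<open>extremal_is_fibre\<close>).
\<close>

section \<open>Sums over the values of a function\<close>

lemma sum_by_value:
  fixes \<phi> :: "'b \<Rightarrow> int"
  assumes "finite S" "finite T" "g ` S \<subseteq> T"
  shows "(\<Sum>x\<in>S. \<phi> (g x)) = (\<Sum>y\<in>T. int (card {x\<in>S. g x = y}) * \<phi> y)"
proof -
  have "(\<Sum>x\<in>S. \<phi> (g x)) = (\<Sum>y\<in>T. \<Sum>x\<in>{x\<in>S. g x = y}. \<phi> (g x))"
    using sum.group[OF assms, of "\<lambda>x. \<phi> (g x)"] by simp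
  also have "\<dots> = (\<Sum>y\<in>T. int (card {x\<in>S. g x = y}) * \<phi> y)"
    by (rule sum.cong) simp_all
  finally show ?thesis .
qed

lemma card_by_value:
  assumes "finite S" "finite T" "g ` S \<subseteq> T"
  shows "card S = (\<Sum>y\<in>T. card {x\<in>S. g x = y})"
  using sum.group[OF assms, of "\<lambda>_. 1::nat"] by simp

lemma exactly_one_of_sum:
  fixes f :: "'b \<Rightarrow> nat"
  assumes "finite L" "\<And>x. x \<in> L \<Longrightarrow> f x = 1 \<or> f x = 2" "(\<Sum>x\<in>L. f x) + 1 = 2 * card L"
  shows "\<exists>!x. x \<in> L \<and> f x = 1"
proof -
  have "(\<Sum>x\<in>L. f x) + (\<Sum>x\<in>L. 2 - f x) = (\<Sum>x\<in>L. 2)"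
    unfolding sum.distrib[symmetric] using assms(2) by (intro sum.cong) force+
  moreover have "(\<Sum>x\<in>L. 2 - f x) = card {x\<in>L. f x = 1}"
  proof -
    have "(\<Sum>x\<in>L. 2 - f x) = (\<Sum>x\<in>L. if f x = 1 then 1 else 0)"
      using assms(2) by (intro sum.cong) force+
    then show ?thesis using assms(1) by (simp add: sum.If_cases Int_def)
  qed
  ultimately have "card {x\<in>L. f x = 1} = 1" using assms(3) by simp
  then obtain x where "{x\<in>L. f x = 1} = {x}" by (rule card_1_singletonE)
  then have "y \<in> L \<and> f y = 1 \<longleftrightarrow> y = x" for y by auto
  then show ?thesis by simp
qed

section \<open>Orthogonal arrays of strength three\<close>

text \<open>
  An orthogonal array of strength three and index one, equivalently the words of an MDS code of
  dimension three: \<open>e h c\<close> is the letter of the word \<open>c\<close> in column \<open>h\<close>. For a Laguerre plane the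
  words are the circles, the columns are the generators, and the letter says in which of its points
  the circle meets the generator; interpolation is the unique circle through three points.
\<close>

locale strength_three_array =
  fixes W :: "'w set" and H :: "'h set" and K :: "'a set" and e :: "'h \<Rightarrow> 'w \<Rightarrow> 'a"
  assumes finite_W: "finite W" and finite_H: "finite H" and finite_K: "finite K"
    and three_columns: "3 \<le> card H"
    and entry: "\<And>h c. h \<in> H \<Longrightarrow> c \<in> W \<Longrightarrow> e h c \<in> K"
    and interpolation: "\<And>h1 h2 h3 a1 a2 a3. \<lbrakk>h1 \<in> H; h2 \<in> H; h3 \<in> H; h1 \<noteq> h2; h1 \<noteq> h3; h2 \<noteq> h3;
        a1 \<in> K; a2 \<in> K; a3 \<in> K\<rbrakk> \<Longrightarrow> \<exists>!c. c \<in> W \<and> e h1 c = a1 \<and> e h2 c = a2 \<and> e h3 c = a3"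
begin

definition agreements :: "'w \<Rightarrow> 'w \<Rightarrow> nat" where
  "agreements c d = card {h\<in>H. e h c = e h d}"

definition line :: "'h \<Rightarrow> 'a \<Rightarrow> 'h \<Rightarrow> 'a \<Rightarrow> 'w set" where
  "line h a h' a' = {c\<in>W. e h c = a \<and> e h' c = a'}"

lemma finite_line: "finite (line h a h' a')"
  using finite_W by (simp add: line_def)

lemma line_commute: "line h a h' a' = line h' a' h a"
  by (auto simp: line_def)

lemma obtain_column:
  assumes "finite Y" "card Y < card H"
  obtains h where "h \<in> H" "h \<notin> Y"
proof -
  have "\<not> H \<subseteq> Y" using card_mono[OF assms(1), of H] assms(2) by auto
  then show thesis using that by blast
qed

lemma word_eqI:
  assumes "h1 \<in> H" "h2 \<in> H" "h3 \<in> H" "h1 \<noteq> h2" "h1 \<noteq> h3" "h2 \<noteq> h3" "c \<in> W" "d \<in> W"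
    and "e h1 c = e h1 d" "e h2 c = e h2 d" "e h3 c = e h3 d"
  shows "c = d"
proof -
  obtain w where w: "\<And>x. x \<in> W \<and> e h1 x = e h1 d \<and> e h2 x = e h2 d \<and> e h3 x = e h3 d \<Longrightarrow> x = w"
    using interpolation[OF assms(1-6), of "e h1 d" "e h2 d" "e h3 d"] entry assms(1-8)
    by (auto elim!: ex1E)
  have "c = w" by (rule w) (simp add: assms)
  moreover have "d = w" by (rule w) (simp add: assms)
  ultimately show ?thesis by simp
qed

lemma interpolating_word:
  assumes "h1 \<in> H" "h2 \<in> H" "h3 \<in> H" "h1 \<noteq> h2" "h1 \<noteq> h3" "h2 \<noteq> h3" "a1 \<in> K" "a2 \<in> K" "a3 \<in> K"
  obtains c where "c \<in> W" "e h1 c = a1" "e h2 c = a2" "e h3 c = a3"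
  using ex1_implies_ex[OF interpolation[OF assms]] by (elim exE conjE)

lemma bij_betw_line:
  assumes "h1 \<in> H" "h2 \<in> H" "h3 \<in> H" "h1 \<noteq> h2" "h1 \<noteq> h3" "h2 \<noteq> h3" "a1 \<in> K" "a2 \<in> K"
  shows "bij_betw (e h3) (line h1 a1 h2 a2) K"
  unfolding bij_betw_def
proof
  show "inj_on (e h3) (line h1 a1 h2 a2)"
  proof (rule inj_onI)
    fix c d assume "c \<in> line h1 a1 h2 a2" "d \<in> line h1 a1 h2 a2" "e h3 c = e h3 d"
    then show "c = d"
      by (intro word_eqI[OF assms(1-6)]) (simp_all add: line_def)
  qed
  show "e h3 ` line h1 a1 h2 a2 = K"
  proof
    show "K \<subseteq> e h3 ` line h1 a1 h2 a2"
    proof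
      fix a assume "a \<in> K"
      then obtain c where "c \<in> W" "e h1 c = a1" "e h2 c = a2" "e h3 c = a"
        by (rule interpolating_word[OF assms])
      then show "a \<in> e h3 ` line h1 a1 h2 a2" by (auto simp: line_def)
    qed
  qed (use entry[OF assms(3)] in \<open>auto simp: line_def\<close>)
qed

lemma card_line:
  assumes "h1 \<in> H" "h2 \<in> H" "h1 \<noteq> h2" "a1 \<in> K" "a2 \<in> K"
  shows "card (line h1 a1 h2 a2) = card K"
proof -
  have "card {h1, h2} < card H" using three_columns assms(3) by simp
  then obtain h3 where "h3 \<in> H" "h3 \<notin> {h1, h2}" using obtain_column[of "{h1,h2}"] by auto
  then show ?thesis
    by (intro bij_betw_same_card[OF bij_betw_line[of h1 h2 h3]]) (use assms in auto)
qed

lemma card_line_at: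
  assumes "h1 \<in> H" "h2 \<in> H" "h3 \<in> H" "h1 \<noteq> h2" "h1 \<noteq> h3" "h2 \<noteq> h3" "a1 \<in> K" "a2 \<in> K" "a3 \<in> K"
  shows "card {c \<in> line h1 a1 h2 a2. e h3 c = a3} = 1"
proof -
  obtain c where c: "c \<in> W" "e h1 c = a1" "e h2 c = a2" "e h3 c = a3"
    by (rule interpolating_word[OF assms])
  have "d = c" if "d \<in> line h1 a1 h2 a2" "e h3 d = a3" for d
    by (rule word_eqI[OF assms(1-6)]) (use that c in \<open>simp_all add: line_def\<close>)
  then have "{c \<in> line h1 a1 h2 a2. e h3 c = a3} = {c}"
    using c unfolding line_def by blast
  then show ?thesis by simp
qed

lemma card_fibre:
  assumes "h \<in> H" "a \<in> K"
  shows "card {c\<in>W. e h c = a} = (card K)\<^sup>2"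
proof -
  have "card {h} < card H" using three_columns by simp
  then obtain h2 where h2: "h2 \<in> H" "h2 \<noteq> h" using obtain_column[of "{h}"] by auto
  have "card {c\<in>W. e h c = a} = (\<Sum>b\<in>K. card {x \<in> {c\<in>W. e h c = a}. e h2 x = b})"
    by (rule card_by_value) (use finite_W finite_K entry h2 in auto)
  also have "\<dots> = (\<Sum>b\<in>K. card K)"
  proof (rule sum.cong)
    fix b assume "b \<in> K"
    have "{x \<in> {c\<in>W. e h c = a}. e h2 x = b} = line h a h2 b" by (auto simp: line_def)
    then show "card {x \<in> {c\<in>W. e h c = a}. e h2 x = b} = card K"
      using card_line[of h h2 a b] assms h2 \<open>b \<in> K\<close> by simp
  qed simp
  finally show ?thesis by (simp add: power2_eq_square)
qed

lemma card_words: "card W = card K ^ 3"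
proof -
  obtain h where h: "h \<in> H" using three_columns by fastforce
  have "card W = (\<Sum>b\<in>K. card {x \<in> W. e h x = b})"
    by (rule card_by_value) (use finite_W finite_K entry h in auto)
  also have "\<dots> = (\<Sum>b\<in>K. (card K)\<^sup>2)"
    by (rule sum.cong) (use card_fibre[OF h] in auto)
  finally show ?thesis by (simp add: power2_eq_square power3_eq_cube)
qed

lemma agreements_self: "agreements c c = card H"
  by (simp add: agreements_def)

lemma agreements_commute: "agreements c d = agreements d c"
  by (simp add: agreements_def eq_commute)

lemma agreements_le_2:
  assumes "c \<in> W" "d \<in> W" "c \<noteq> d"
  shows "agreements c d \<le> 2"
proof (rule ccontr)
  assume "\<not> agreements c d \<le> 2"
  then have "3 \<le> card {h\<in>H. e h c = e h d}" by (simp add: agreements_def)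
  then obtain T where "T \<subseteq> {h\<in>H. e h c = e h d}" "card T = 3"
    by (meson obtain_subset_with_card_n)
  then obtain x y z where "x \<in> H" "y \<in> H" "z \<in> H" "x \<noteq> y" "x \<noteq> z" "y \<noteq> z"
    and "e x c = e x d" "e y c = e y d" "e z c = e z d"
    by (auto simp: card_3_iff)
  then show False
    using word_eqI[of x y z c d] assms by blast
qed

lemma agreements_pos: "agreements c d > 0 \<longleftrightarrow> (\<exists>h\<in>H. e h c = e h d)"
  using finite_H by (auto simp: agreements_def card_gt_0_iff)

lemma agreements_ge_2:
  assumes "h \<in> H" "h' \<in> H" "h \<noteq> h'" "e h c = e h d" "e h' c = e h' d"
  shows "2 \<le> agreements c d"
proof -
  have "card {h, h'} \<le> card {h\<in>H. e h c = e h d}"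
    by (rule card_mono) (use finite_H assms in auto)
  then show ?thesis using assms(3) by (simp add: agreements_def)
qed

lemma sum_agreements:
  assumes "finite L"
  shows "(\<Sum>d\<in>L. agreements c d) = (\<Sum>h\<in>H. card {d\<in>L. e h d = e h c})"
proof -
  have "(\<Sum>d\<in>L. agreements c d) = (\<Sum>d\<in>L. \<Sum>h\<in>H. if e h d = e h c then 1 else 0)"
  proof (rule sum.cong)
    fix d
    have "H \<inter> {h. e h d = e h c} = {h\<in>H. e h c = e h d}" by auto
    then show "agreements c d = (\<Sum>h\<in>H. if e h d = e h c then 1 else 0)"
      by (simp add: agreements_def sum.If_cases finite_H)
  qed simp
  also have "\<dots> = (\<Sum>h\<in>H. \<Sum>d\<in>L. if e h d = e h c then 1 else 0)"
    by (rule sum.swap)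
  also have "\<dots> = (\<Sum>h\<in>H. card {d\<in>L. e h d = e h c})"
    by (simp add: assms sum.If_cases Int_def)
  finally show ?thesis .
qed

end

section \<open>Weights of words\<close>

context strength_three_array
begin

definition occurrences :: "'w set \<Rightarrow> 'h \<Rightarrow> 'a \<Rightarrow> int" where
  "occurrences A h a = int (card {c\<in>A. e h c = a})"

text \<open>
  By \<open>weight_eq_sum_agreements\<close> below this is the number of agreements of \<open>c\<close> with the members of
  \<open>A\<close>. Up to scaling and a constant it is also the orthogonal projection of the indicator function
  of \<open>A\<close> onto the functions of the form \<open>\<lambda>c. \<Sum>h\<in>H. f h (e h c)\<close>. The tension between these two
  descriptions drives the argument. Counts are integers because differences of them occur throughout.
\<close>

definition weight :: "'w set \<Rightarrow> 'w \<Rightarrow> int" where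
  "weight A c = (\<Sum>h\<in>H. occurrences A h (e h c))"

lemma sum_occurrences:
  assumes "A \<subseteq> W" "h \<in> H"
  shows "(\<Sum>a\<in>K. occurrences A h a) = int (card A)"
proof -
  have "card A = (\<Sum>a\<in>K. card {c\<in>A. e h c = a})"
    by (rule card_by_value) (use assms finite_subset[OF _ finite_W] finite_K entry in auto)
  then show ?thesis by (simp add: occurrences_def)
qed

lemma occurrences_words:
  assumes "h \<in> H" "a \<in> K"
  shows "occurrences W h a = (int (card K))\<^sup>2"
  using card_fibre[OF assms] by (simp add: occurrences_def)

lemma weight_eq_sum_agreements:
  assumes "finite A"
  shows "weight A c = (\<Sum>d\<in>A. int (agreements c d))"
  using sum_agreements[OF assms, of c] by (simp add: weight_def occurrences_def flip: of_nat_sum)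

lemma sum_weight:
  assumes "B \<subseteq> W"
  shows "(\<Sum>c\<in>B. weight A c) = (\<Sum>h\<in>H. \<Sum>a\<in>K. occurrences B h a * occurrences A h a)"
proof -
  have "(\<Sum>c\<in>B. weight A c) = (\<Sum>h\<in>H. \<Sum>c\<in>B. occurrences A h (e h c))"
    unfolding weight_def by (rule sum.swap)
  also have "\<dots> = (\<Sum>h\<in>H. \<Sum>a\<in>K. occurrences B h a * occurrences A h a)"
  proof (rule sum.cong)
    fix h assume h: "h \<in> H"
    show "(\<Sum>c\<in>B. occurrences A h (e h c)) = (\<Sum>a\<in>K. occurrences B h a * occurrences A h a)"
      unfolding occurrences_def[of B]
      by (rule sum_by_value) (use assms finite_subset[OF _ finite_W] finite_K entry h in auto)
  qed simp
  finally show ?thesis .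
qed

lemma sum_weight_words:
  assumes "A \<subseteq> W"
  shows "(\<Sum>c\<in>W. weight A c) = int (card H) * (int (card K))\<^sup>2 * int (card A)"
proof -
  have "(\<Sum>c\<in>W. weight A c) = (\<Sum>h\<in>H. \<Sum>a\<in>K. occurrences W h a * occurrences A h a)"
    by (rule sum_weight) simp
  also have "\<dots> = (\<Sum>h\<in>H. (int (card K))\<^sup>2 * int (card A))"
    by (intro sum.cong) (simp_all add: occurrences_words sum_occurrences[OF assms] flip: sum_distrib_left)
  finally show ?thesis by simp
qed

text \<open>
  Inside the words with letter \<open>a\<close> in column \<open>h\<close>, every other column takes each letter equally
  often, so only column \<open>h\<close> contributes something that depends on more than the size of \<open>A\<close>.
\<close>

lemma sum_weight_fibre:
  assumes A: "A \<subseteq> W" and h: "h \<in> H" and a: "a \<in> K"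
  shows "(\<Sum>c\<in>{c\<in>W. e h c = a}. weight A c) =
    (int (card K))\<^sup>2 * occurrences A h a + (int (card H) - 1) * int (card K) * int (card A)"
proof -
  let ?S = "{c\<in>W. e h c = a}"
  have S: "?S \<subseteq> W" by auto
  have other: "(\<Sum>b\<in>K. occurrences ?S h' b * occurrences A h' b) = int (card K) * int (card A)"
    if h': "h' \<in> H - {h}" for h'
  proof -
    have "occurrences ?S h' b = int (card K)" if "b \<in> K" for b
    proof -
      have "{c\<in>?S. e h' c = b} = line h a h' b" by (auto simp: line_def)
      then show ?thesis using card_line[of h h' a b] h a h' that by (auto simp: occurrences_def)
    qed
    then show ?thesis using sum_occurrences[OF A, of h'] h' by (simp flip: sum_distrib_left)
  qed
  have same: "(\<Sum>b\<in>K. occurrences ?S h b * occurrences A h b) = (int (card K))\<^sup>2 * occurrences A h a"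
  proof -
    have "occurrences ?S h b = (if b = a then (int (card K))\<^sup>2 else 0)" for b
    proof -
      have "{c\<in>?S. e h c = b} = (if b = a then ?S else {})" by auto
      then show ?thesis using card_fibre[OF h a] by (simp add: occurrences_def)
    qed
    then have "(\<Sum>b\<in>K. occurrences ?S h b * occurrences A h b)
        = (\<Sum>b\<in>K. if b = a then (int (card K))\<^sup>2 * occurrences A h b else 0)"
      by (intro sum.cong) auto
    then show ?thesis using a finite_K by simp
  qed
  have "(\<Sum>c\<in>?S. weight A c) = (\<Sum>h'\<in>H. \<Sum>b\<in>K. occurrences ?S h' b * occurrences A h' b)"
    by (rule sum_weight[OF S])
  also have "\<dots> = (int (card K))\<^sup>2 * occurrences A h a + (\<Sum>h'\<in>H - {h}. int (card K) * int (card A))"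
    by (subst sum.remove[OF finite_H h]) (simp add: same other)
  finally show ?thesis
    using h finite_H three_columns by (simp add: card_Diff_singleton of_nat_diff)
qed

lemma sum_weight_line:
  assumes A: "A \<subseteq> W" and h: "h1 \<in> H" "h2 \<in> H" "h1 \<noteq> h2" and a: "a1 \<in> K" "a2 \<in> K"
  shows "(\<Sum>c\<in>line h1 a1 h2 a2. weight A c) =
    int (card K) * (occurrences A h1 a1 + occurrences A h2 a2) + (int (card H) - 2) * int (card A)"
proof -
  let ?S = "line h1 a1 h2 a2"
  have S: "?S \<subseteq> W" by (auto simp: line_def)
  have other: "(\<Sum>b\<in>K. occurrences ?S h b * occurrences A h b) = int (card A)"
    if h': "h \<in> H - {h1} - {h2}" for h
  proof -
    have "occurrences ?S h b = 1" if "b \<in> K" for b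
      using card_line_at[of h1 h2 h a1 a2 b] h a h' that by (auto simp: occurrences_def)
    then show ?thesis using sum_occurrences[OF A, of h] h' by simp
  qed
  have same: "(\<Sum>b\<in>K. occurrences ?S h b * occurrences A h b) = int (card K) * occurrences A h a"
    if "\<And>c. c \<in> ?S \<Longrightarrow> e h c = a" "a \<in> K" for h a
  proof -
    have "occurrences ?S h b = (if b = a then int (card K) else 0)" for b
    proof -
      have "{c\<in>?S. e h c = b} = (if b = a then ?S else {})" using that by auto
      then show ?thesis using card_line[OF h a] by (simp add: occurrences_def)
    qed
    then have "(\<Sum>b\<in>K. occurrences ?S h b * occurrences A h b)
        = (\<Sum>b\<in>K. if b = a then int (card K) * occurrences A h b else 0)"
      by (intro sum.cong) auto
    then show ?thesis using that(2) finite_K by simp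
  qed
  have at1: "(\<Sum>b\<in>K. occurrences ?S h1 b * occurrences A h1 b) = int (card K) * occurrences A h1 a1"
    by (rule same) (simp_all add: line_def a)
  have at2: "(\<Sum>b\<in>K. occurrences ?S h2 b * occurrences A h2 b) = int (card K) * occurrences A h2 a2"
    by (rule same) (simp_all add: line_def a)
  have "(\<Sum>c\<in>?S. weight A c) = (\<Sum>h'\<in>H. \<Sum>b\<in>K. occurrences ?S h' b * occurrences A h' b)"
    by (rule sum_weight[OF S])
  also have "\<dots> = int (card K) * occurrences A h1 a1
      + (int (card K) * occurrences A h2 a2 + (\<Sum>h'\<in>H - {h1} - {h2}. int (card A)))"
    using h finite_H other
    by (simp add: sum.remove[OF finite_H h(1)] sum.remove[of "H - {h1}" h2] at1 at2)
  finally show ?thesis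
    using h finite_H three_columns
    by (simp add: card_Diff_singleton of_nat_diff algebra_simps)
qed

lemma sum_weight_square:
  assumes A: "A \<subseteq> W"
  shows "(\<Sum>c\<in>W. (weight A c)\<^sup>2) = (int (card K))\<^sup>2 * (\<Sum>c\<in>A. weight A c)
    + int (card H) * (int (card H) - 1) * int (card K) * (int (card A))\<^sup>2"
proof -
  let ?q = "int (card K)" and ?x = "int (card A)" and ?m = "int (card H)"
  have "(\<Sum>c\<in>W. (weight A c)\<^sup>2) = (\<Sum>c\<in>W. \<Sum>h\<in>H. occurrences A h (e h c) * weight A c)"
    by (simp add: power2_eq_square weight_def sum_distrib_right)
  also have "\<dots> = (\<Sum>h\<in>H. \<Sum>c\<in>W. occurrences A h (e h c) * weight A c)"
    by (rule sum.swap)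
  also have "\<dots> = (\<Sum>h\<in>H. ?q\<^sup>2 * (\<Sum>a\<in>K. occurrences A h a * occurrences A h a) + (?m - 1) * ?q * ?x\<^sup>2)"
  proof (rule sum.cong)
    fix h assume h: "h \<in> H"
    have "(\<Sum>c\<in>W. occurrences A h (e h c) * weight A c)
        = (\<Sum>a\<in>K. \<Sum>c\<in>{c\<in>W. e h c = a}. occurrences A h (e h c) * weight A c)"
      by (rule sum.group[symmetric]) (use finite_W finite_K entry h in auto)
    also have "\<dots> = (\<Sum>a\<in>K. occurrences A h a * (\<Sum>c\<in>{c\<in>W. e h c = a}. weight A c))"
      by (simp add: sum_distrib_left)
    also have "\<dots> = (\<Sum>a\<in>K. ?q\<^sup>2 * (occurrences A h a * occurrences A h a) + (?m - 1) * ?q * ?x * occurrences A h a)"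
      by (intro sum.cong) (simp_all add: sum_weight_fibre[OF A h] algebra_simps)
    also have "\<dots> = ?q\<^sup>2 * (\<Sum>a\<in>K. occurrences A h a * occurrences A h a) + (?m - 1) * ?q * ?x * (\<Sum>a\<in>K. occurrences A h a)"
      by (simp add: sum.distrib flip: sum_distrib_left)
    finally show "(\<Sum>c\<in>W. occurrences A h (e h c) * weight A c)
        = ?q\<^sup>2 * (\<Sum>a\<in>K. occurrences A h a * occurrences A h a) + (?m - 1) * ?q * ?x\<^sup>2"
      by (simp add: sum_occurrences[OF A h] power2_eq_square)
  qed simp
  also have "\<dots> = ?q\<^sup>2 * (\<Sum>h\<in>H. \<Sum>a\<in>K. occurrences A h a * occurrences A h a) + ?m * ((?m - 1) * ?q * ?x\<^sup>2)"
    by (simp add: sum.distrib flip: sum_distrib_left)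
  finally show ?thesis by (simp add: sum_weight[OF A])
qed

end

section \<open>Intersecting families in arrays with two more columns than letters\<close>

text \<open>
  This number of columns belongs to the hyperoval that an oval and its nucleus form. Just as a line
  of a projective plane meets a hyperoval in no point or in two, different words agree in no
  column or in exactly two, by \<open>agreements_ne_1\<close> and \<open>agreements_le_2\<close>.
\<close>

locale maximal_strength_three_array = strength_three_array W H K e
  for W :: "'w set" and H :: "'h set" and K :: "'a set" and e :: "'h \<Rightarrow> 'w \<Rightarrow> 'a" +
  assumes card_columns: "card H = card K + 2"
begin

lemma agreements_ne_1:
  assumes "c \<in> W" "d \<in> W"
  shows "agreements c d \<noteq> 1"
proof
  assume one: "agreements c d = 1"
  then obtain h where h: "h \<in> H" "e h d = e h c"
    using agreements_pos[of c d] by auto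
  let ?a = "e h c"
  have a: "?a \<in> K" using entry h assms by simp
  let ?S = "{x\<in>W. e h x = ?a}"
  have fin: "finite ?S" using finite_W by simp
  have d: "d \<in> ?S" "d \<noteq> c" using h assms one agreements_self card_columns by auto
  have c: "c \<in> ?S" using assms by simp
  \<comment> \<open>The words that agree with \<open>c\<close> in column \<open>h\<close> have \<open>2 q\<^sup>2 + q\<close> agreements with it in all, which
    is what results if every one of them other than \<open>c\<close> has two; the word \<open>d\<close> leaves a deficit.\<close>
  have "(\<Sum>x\<in>?S. agreements c x) = (\<Sum>h'\<in>H. card {x\<in>?S. e h' x = e h' c})"
    by (rule sum_agreements[OF fin])
  also have "\<dots> = card ?S + (\<Sum>h'\<in>H - {h}. card K)"
  proof (subst sum.remove[OF finite_H h(1)], intro arg_cong2[of _ _ _ _ "(+)"] sum.cong)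
    fix h' assume h': "h' \<in> H - {h}"
    have "{x\<in>?S. e h' x = e h' c} = line h ?a h' (e h' c)" by (auto simp: line_def)
    then show "card {x\<in>?S. e h' x = e h' c} = card K"
      using card_line[of h h' ?a "e h' c"] h h' a entry[of h' c] assms by auto
  qed (auto intro: arg_cong[of _ _ card])
  also have "\<dots> = 2 * (card K)\<^sup>2 + card K"
    using h finite_H card_fibre[OF h(1) a] card_columns
    by (simp add: card_Diff_singleton algebra_simps power2_eq_square)
  finally have total: "(\<Sum>x\<in>?S. agreements c x) = 2 * (card K)\<^sup>2 + card K" .
  have "(\<Sum>x\<in>?S. agreements c x) = agreements c c + (agreements c d + (\<Sum>x\<in>?S - {c} - {d}. agreements c x))"
    using c d fin by (subst sum.remove[OF fin c], subst sum.remove[of "?S - {c}" d]) auto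
  also have "\<dots> \<le> card K + 2 + (1 + (\<Sum>x\<in>?S - {c} - {d}. 2))"
    unfolding agreements_self card_columns one
    by (intro add_left_mono sum_mono) (auto intro!: agreements_le_2 assms)
  also have "\<dots> < 2 * (card K)\<^sup>2 + card K"
  proof -
    have "card {c, d} \<le> card ?S" by (rule card_mono[OF fin]) (use c d in auto)
    then have "2 \<le> (card K)\<^sup>2" using card_fibre[OF h(1) a] d(2) by simp
    moreover have "card (?S - {c} - {d}) = (card K)\<^sup>2 - 2"
      using c d fin card_fibre[OF h(1) a] by simp
    ultimately show ?thesis by simp
  qed
  finally show False using total by simp
qed

text \<open>
  A member of an intersecting family agrees with every other member in exactly two columns and with
  itself in all \<open>card K + 2\<close>, so the weight is constant on the family.
\<close>

lemma weight_of_member: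
  assumes "A \<subseteq> W" "\<And>c d. c \<in> A \<Longrightarrow> d \<in> A \<Longrightarrow> \<exists>h\<in>H. e h c = e h d" "c \<in> A"
  shows "weight A c = 2 * int (card A) + int (card K)"
proof -
  have fin: "finite A" using assms(1) finite_W finite_subset by blast
  have two: "agreements c d = 2" if "d \<in> A - {c}" for d
  proof -
    have d: "c \<in> W" "d \<in> W" "c \<noteq> d" using that assms by auto
    have "agreements c d > 0" unfolding agreements_pos using that assms by blast
    then show ?thesis using agreements_le_2[OF d] agreements_ne_1[OF d(1,2)] by linarith
  qed
  have "weight A c = int (agreements c c) + (\<Sum>d\<in>A - {c}. int (agreements c d))"
    unfolding weight_eq_sum_agreements[OF fin] by (rule sum.remove[OF fin assms(3)])
  also have "\<dots> = int (card K) + 2 + 2 * (int (card A) - 1)"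
    using assms(3) fin card_gt_0_iff[of A]
    by (auto simp: two agreements_self card_columns card_Diff_singleton of_nat_diff)
  finally show ?thesis by simp
qed

text \<open>
  The square of the distance, scaled by \<open>q\<^sup>6\<close>, from the indicator function of \<open>A\<close> to its projection
  onto the sums of functions of one column. It can be computed because the weight is constant on
  \<open>A\<close> and its first two moments over all words are known. Nonnegativity gives the bound on \<open>A\<close>,
  and in the case of equality the indicator function is itself such a sum.
\<close>

lemma variance_identity:
  assumes A: "A \<subseteq> W" and meet: "\<And>c d. c \<in> A \<Longrightarrow> d \<in> A \<Longrightarrow> \<exists>h\<in>H. e h c = e h d"
  defines "q \<equiv> int (card K)" and "x \<equiv> int (card A)"
  shows "(\<Sum>c\<in>W. (q * weight A c - (q + 1) * x - (if c \<in> A then q ^ 3 else 0))\<^sup>2)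
    = q ^ 3 * (q - 1) * x * (q\<^sup>2 - x)"
proof -
  have WA: "W \<inter> A = A" using A by auto
  have m: "int (card H) = q + 2" by (simp add: card_columns q_def)
  have sumA: "(\<Sum>c\<in>A. weight A c) = x * (2 * x + q)"
    using weight_of_member[OF A meet] by (simp add: x_def q_def)
  have sumW: "(\<Sum>c\<in>W. weight A c) = (q + 2) * q\<^sup>2 * x"
    using sum_weight_words[OF A] m by (simp add: x_def q_def)
  have sumW2: "(\<Sum>c\<in>W. (weight A c)\<^sup>2) = q\<^sup>2 * (x * (2 * x + q)) + (q + 2) * (q + 1) * q * x\<^sup>2"
    using sum_weight_square[OF A] m sumA by (simp add: x_def q_def)
  have cW: "int (card W) = q ^ 3" by (simp add: card_words q_def)
  let ?y = "\<lambda>c. q * weight A c - (q + 1) * x"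
  have "(\<Sum>c\<in>W. (?y c - (if c \<in> A then q ^ 3 else 0))\<^sup>2)
      = (\<Sum>c\<in>W. (q\<^sup>2 * (weight A c)\<^sup>2 - 2 * q * (q + 1) * x * weight A c + ((q + 1) * x)\<^sup>2)
          + (if c \<in> A then q ^ 6 - 2 * q ^ 3 * ?y c else 0))"
    by (rule sum.cong) (auto simp: power2_eq_square algebra_simps eval_nat_numeral)
  also have "\<dots> = q\<^sup>2 * (\<Sum>c\<in>W. (weight A c)\<^sup>2) - 2 * q * (q + 1) * x * (\<Sum>c\<in>W. weight A c)
      + int (card W) * ((q + 1) * x)\<^sup>2
      + (x * q ^ 6 - 2 * q ^ 3 * (q * (\<Sum>c\<in>A. weight A c) - x * ((q + 1) * x)))"
    by (simp add: sum.distrib sum_subtractf sum.If_cases finite_W WA x_def flip: sum_distrib_left)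
  also have "\<dots> = q ^ 3 * (q - 1) * x * (q\<^sup>2 - x)"
    unfolding sumA sumW sumW2 cW by (simp add: algebra_simps eval_nat_numeral)
  finally show ?thesis .
qed

theorem intersecting_bound:
  assumes "A \<subseteq> W" "\<And>c d. c \<in> A \<Longrightarrow> d \<in> A \<Longrightarrow> \<exists>h\<in>H. e h c = e h d" "card K > 1"
  shows "card A \<le> (card K)\<^sup>2"
proof (rule ccontr)
  let ?q = "int (card K)" and ?x = "int (card A)"
  assume "\<not> card A \<le> (card K)\<^sup>2"
  then have big: "?q\<^sup>2 < ?x" by (metis not_le of_nat_less_iff of_nat_power)
  have "0 \<le> ?q ^ 3 * (?q - 1) * ?x * (?q\<^sup>2 - ?x)"
    by (subst variance_identity[OF assms(1,2), symmetric]) (auto intro: sum_nonneg)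
  moreover have "?q ^ 3 * (?q - 1) * ?x > 0"
    using assms(3) big by (intro mult_pos_pos) (auto intro: le_less_trans[OF zero_le_power2])
  ultimately show False using big by (simp add: zero_le_mult_iff)
qed

text \<open>
  Equality in the bound makes every summand of the variance vanish, which determines the weight of
  each word, inside and outside the family.
\<close>

lemma weight_extremal:
  assumes A: "A \<subseteq> W" and meet: "\<And>c d. c \<in> A \<Longrightarrow> d \<in> A \<Longrightarrow> \<exists>h\<in>H. e h c = e h d"
    and max: "card A = (card K)\<^sup>2" and K: "card K > 1" and c: "c \<in> W"
  shows "weight A c = (int (card K))\<^sup>2 + int (card K) + (if c \<in> A then (int (card K))\<^sup>2 else 0)"
proof -
  let ?q = "int (card K)"
  have "(\<Sum>c\<in>W. (?q * weight A c - (?q + 1) * int (card A) - (if c \<in> A then ?q ^ 3 else 0))\<^sup>2) = 0"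
    by (subst variance_identity[OF A meet]) (auto simp: max)
  then have "?q * weight A c - (?q + 1) * int (card A) - (if c \<in> A then ?q ^ 3 else 0) = 0"
    using sum_nonneg_eq_0_iff[OF finite_W] c by (metis (no_types, lifting) zero_eq_power2 zero_le_power2)
  then have "?q * weight A c = ?q * (?q\<^sup>2 + ?q + (if c \<in> A then ?q\<^sup>2 else 0))"
    by (auto simp: max algebra_simps eval_nat_numeral)
  then show ?thesis using K by simp
qed

context
  fixes A :: "'w set"
  assumes A: "A \<subseteq> W" and meet: "\<And>c d. c \<in> A \<Longrightarrow> d \<in> A \<Longrightarrow> \<exists>h\<in>H. e h c = e h d"
    and max: "card A = (card K)\<^sup>2" and K: "card K > 1"
begin

lemma finite_A: "finite A"
  using A finite_W finite_subset by blast

text \<open>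
  Sum the weights along a line: the sum is known from \<open>weight_extremal\<close> and also, by strength three,
  from the two columns that are fixed on the line.
\<close>

lemma line_count:
  assumes h: "h1 \<in> H" "h2 \<in> H" "h1 \<noteq> h2" and a: "a1 \<in> K" "a2 \<in> K"
  shows "int (card K) * int (card (A \<inter> line h1 a1 h2 a2)) = occurrences A h1 a1 + occurrences A h2 a2 - int (card K)"
proof -
  let ?q = "int (card K)" and ?L = "line h1 a1 h2 a2"
  have fin: "finite ?L" by (rule finite_line)
  have "(\<Sum>c\<in>?L. weight A c) = (\<Sum>c\<in>?L. ?q\<^sup>2 + ?q + (if c \<in> A then ?q\<^sup>2 else 0))"
    by (rule sum.cong) (use weight_extremal[OF A meet max K] in \<open>auto simp: line_def\<close>)
  also have "\<dots> = ?q * (?q\<^sup>2 + ?q) + ?q\<^sup>2 * int (card (A \<inter> ?L))"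
    using card_line[OF h a] fin
    by (simp add: sum.distrib sum.If_cases Int_commute algebra_simps)
  finally have "?q * (occurrences A h1 a1 + occurrences A h2 a2) + ?q * ?q\<^sup>2
      = ?q * (?q\<^sup>2 + ?q) + ?q\<^sup>2 * int (card (A \<inter> ?L))"
    using sum_weight_line[OF A h a] by (simp add: card_columns max)
  then have "?q * (occurrences A h1 a1 + occurrences A h2 a2) = ?q * (?q + ?q * int (card (A \<inter> ?L)))"
    by (simp add: algebra_simps power2_eq_square)
  then show ?thesis using K by simp
qed

text \<open>
  Sum the weights over the members with letter \<open>a\<close> in column \<open>h\<close>. Since the family meets every line
  in a known number of words, this yields a quadratic equation for \<open>n = occurrences A h a\<close> whose
  constant term involves only the sum of squares of the occurrences in column \<open>h\<close>. Those
  \<open>q\<close> numbers add up to \<open>q\<^sup>2\<close>, so their squares add up to at least \<open>q\<^sup>3\<close>, and the equation becomes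
  an inequality that factors.
\<close>

lemma occurrences_dichotomy:
  assumes h: "h \<in> H" and a: "a \<in> K"
  shows "(occurrences A h a - int (card K)) * (occurrences A h a - ((int (card K))\<^sup>2 - int (card K))) \<ge> 0"
proof -
  let ?q = "int (card K)" and ?n = "occurrences A h a" and ?S = "{c\<in>A. e h c = a}"
  have S: "?S \<subseteq> W" using A by auto
  define N where "N = (\<lambda>h. \<Sum>b\<in>K. occurrences A h b * occurrences A h b)"
  have sumN: "(\<Sum>h\<in>H. N h) = ?q\<^sup>2 * (2 * ?q\<^sup>2 + ?q)"
    unfolding N_def using sum_weight[OF A, of A] weight_of_member[OF A meet] by (simp add: max)
  have "?n * (2 * ?q\<^sup>2 + ?q) = (\<Sum>c\<in>?S. weight A c)"
    using weight_of_member[OF A meet] by (simp add: max occurrences_def)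
  also have "\<dots> = (\<Sum>h'\<in>H. \<Sum>b\<in>K. occurrences ?S h' b * occurrences A h' b)"
    by (rule sum_weight[OF S])
  also have "\<dots> = ?n * ?n + (\<Sum>h'\<in>H - {h}. \<Sum>b\<in>K. occurrences ?S h' b * occurrences A h' b)"
  proof -
    have "occurrences ?S h b = (if b = a then ?n else 0)" for b
    proof -
      have "{c\<in>?S. e h c = b} = (if b = a then ?S else {})" by auto
      then show ?thesis by (simp add: occurrences_def)
    qed
    then have "(\<Sum>b\<in>K. occurrences ?S h b * occurrences A h b) = (\<Sum>b\<in>K. if b = a then ?n * occurrences A h b else 0)"
      by (intro sum.cong) auto
    then have "(\<Sum>b\<in>K. occurrences ?S h b * occurrences A h b) = ?n * ?n" using a finite_K by simp
    then show ?thesis by (simp add: sum.remove[OF finite_H h])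
  qed
  finally have "?q * (?n * (2 * ?q\<^sup>2 + ?q) - ?n * ?n)
      = (\<Sum>h'\<in>H - {h}. \<Sum>b\<in>K. (?q * occurrences ?S h' b) * occurrences A h' b)"
    by (simp add: sum_distrib_left mult.assoc)
  also have "\<dots> = (\<Sum>h'\<in>H - {h}. (?n - ?q) * ?q\<^sup>2 + N h')"
  proof (rule sum.cong)
    fix h' assume h': "h' \<in> H - {h}"
    have cnt: "?q * occurrences ?S h' b = ?n + occurrences A h' b - ?q" if "b \<in> K" for b
    proof -
      have "{c\<in>?S. e h' c = b} = A \<inter> line h a h' b" using A by (auto simp: line_def)
      then show ?thesis using line_count[of h h' a b] h h' a that by (auto simp: occurrences_def)
    qed
    have "(\<Sum>b\<in>K. (?q * occurrences ?S h' b) * occurrences A h' b)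
        = (\<Sum>b\<in>K. (?n - ?q) * occurrences A h' b + occurrences A h' b * occurrences A h' b)"
      by (rule sum.cong[OF refl], subst cnt, assumption, simp add: algebra_simps)
    also have "\<dots> = (?n - ?q) * ?q\<^sup>2 + N h'"
      using sum_occurrences[OF A, of h'] h' by (simp add: sum.distrib max N_def flip: sum_distrib_left)
    finally show "(\<Sum>b\<in>K. (?q * occurrences ?S h' b) * occurrences A h' b) = (?n - ?q) * ?q\<^sup>2 + N h'" .
  qed simp
  also have "\<dots> = (?q + 1) * ((?n - ?q) * ?q\<^sup>2) + (?q\<^sup>2 * (2 * ?q\<^sup>2 + ?q) - N h)"
    using h finite_H sumN
    by (simp add: sum.distrib card_columns card_Diff_singleton sum_diff1)
  \<comment> \<open>The quadratic equation; the squares of the deviations from the mean \<open>q\<close> bound its left side.\<close>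
  finally have Nh: "N h = ?q * (?n * ?n - ?q\<^sup>2 * ?n + ?q ^ 3)"
    by (simp add: algebra_simps eval_nat_numeral)
  have "0 \<le> (\<Sum>b\<in>K. (occurrences A h b - ?q)\<^sup>2)" by (rule sum_nonneg) simp
  also have "\<dots> = (\<Sum>b\<in>K. occurrences A h b * occurrences A h b - 2 * ?q * occurrences A h b + ?q\<^sup>2)"
    by (intro sum.cong) (simp_all add: algebra_simps power2_eq_square)
  also have "\<dots> = N h - ?q ^ 3"
    using sum_occurrences[OF A h]
    by (simp add: sum.distrib sum_subtractf max N_def eval_nat_numeral flip: sum_distrib_left)
  finally have "0 \<le> ?q * (?n * ?n - ?q\<^sup>2 * ?n + ?q ^ 3 - ?q\<^sup>2)"
    unfolding Nh by (simp add: algebra_simps eval_nat_numeral)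
  then have "0 \<le> ?n * ?n - ?q\<^sup>2 * ?n + ?q ^ 3 - ?q\<^sup>2"
    using K by (simp add: zero_le_mult_iff)
  then show ?thesis by (simp add: algebra_simps eval_nat_numeral)
qed

text \<open>
  The letters of a member \<open>c\<close> occur \<open>2 q\<^sup>2 + q\<close> times in all, too often for each of them to occur at
  most \<open>q\<close> times. By the dichotomy some letter then occurs at least \<open>q\<^sup>2 - q\<close> times. A line contains at most
  \<open>q\<close> members, so by \<open>line_count\<close> each other letter of \<open>c\<close> occurs at most \<open>2 q\<close> times, which for \<open>q > 3\<close>
  is below \<open>q\<^sup>2 - q\<close>, and so at most \<open>q\<close> times by the dichotomy again. What remains for the first
  letter is \<open>q\<^sup>2\<close>, the size of the whole family.
\<close>

lemma extremal_is_fibre: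
  assumes K3: "card K > 3"
  shows "\<exists>h\<in>H. \<exists>a\<in>K. A = {c\<in>W. e h c = a}"
proof -
  let ?q = "int (card K)"
  have qq: "?q * ?q > 3 * ?q" using K3 by simp
  have "A \<noteq> {}" using max K by auto
  then obtain c where c: "c \<in> A" by blast
  have wt: "weight A c = 2 * ?q\<^sup>2 + ?q"
    using weight_of_member[OF A meet c] by (simp add: max)
  have eK: "e h c \<in> K" if "h \<in> H" for h using entry that c A by blast
  have "\<exists>h\<in>H. occurrences A h (e h c) > ?q"
  proof (rule ccontr)
    assume "\<not> (\<exists>h\<in>H. occurrences A h (e h c) > ?q)"
    then have "occurrences A h (e h c) \<le> ?q" if "h \<in> H" for h using that by force
    then have "weight A c \<le> (\<Sum>h\<in>H. ?q)" unfolding weight_def by (rule sum_mono)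
    then show False using wt qq K3 by (simp add: card_columns power2_eq_square algebra_simps)
  qed
  then obtain h where h: "h \<in> H" "occurrences A h (e h c) > ?q" by blast
  let ?a = "e h c"
  have large: "occurrences A h ?a \<ge> ?q\<^sup>2 - ?q"
    using occurrences_dichotomy[OF h(1) eK[OF h(1)]] h(2) by (simp add: zero_le_mult_iff)
  have small: "occurrences A h' (e h' c) \<le> ?q" if h': "h' \<in> H - {h}" for h'
  proof -
    let ?n = "occurrences A h' (e h' c)"
    have "card (A \<inter> line h ?a h' (e h' c)) \<le> card K"
      using card_line[of h h' ?a "e h' c"] card_mono[OF finite_line] eK h h'
      by (metis DiffE Int_lower2 insertI1)
    then have "?q * int (card (A \<inter> line h ?a h' (e h' c))) \<le> ?q * ?q"
      by (intro mult_left_mono) auto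
    then have "?n \<le> 2 * ?q"
      using line_count[of h h' ?a "e h' c"] eK h h' large by (auto simp: power2_eq_square)
    then have "?n < ?q\<^sup>2 - ?q" using qq by (simp add: power2_eq_square)
    then show ?thesis
      using occurrences_dichotomy[of h' "e h' c"] eK h' by (auto simp: zero_le_mult_iff)
  qed
  have "weight A c \<le> occurrences A h ?a + (\<Sum>h'\<in>H - {h}. ?q)"
    unfolding weight_def sum.remove[OF finite_H h(1)] using small by (intro add_left_mono sum_mono)
  then have "?q\<^sup>2 \<le> occurrences A h ?a"
    using wt h(1) finite_H by (simp add: card_columns card_Diff_singleton power2_eq_square algebra_simps)
  then have "card A \<le> card {c\<in>A. e h c = ?a}" by (simp add: max occurrences_def flip: of_nat_power)
  then have "{c\<in>A. e h c = ?a} = A"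
    by (intro card_seteq finite_A) auto
  then have "A = {d\<in>W. e h d = ?a}"
    using A max card_fibre[OF h(1) eK[OF h(1)]] finite_W by (intro card_subset_eq) auto
  then show ?thesis using h(1) eK by blast
qed

end

end

section \<open>Touching words in arrays with one more column than letters\<close>

text \<open>
  The array of a Laguerre plane of even order. Parity supplies one more column, whose letters are
  the classes of mutually touching words; for the cone over an oval it belongs to the nucleus of the
  oval.
\<close>

locale even_laguerre_array = strength_three_array W H K e
  for W :: "'w set" and H :: "'h set" and K :: "'a set" and e :: "'h \<Rightarrow> 'w \<Rightarrow> 'a" +
  assumes card_columns: "card H = card K + 1" and even_K: "even (card K)"
begin

text \<open>
  Equality is included because touching is going to be an equivalence relation, and because it makes
  \<open>touching_word\<close> hold for all pairs of points, including two points of \<open>c\<close> itself.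
\<close>

definition touches :: "'w \<Rightarrow> 'w \<Rightarrow> bool" where
  "touches c d \<longleftrightarrow> c = d \<or> agreements c d = 1"

lemma touches_commute: "touches c d \<longleftrightarrow> touches d c"
  by (auto simp: touches_def agreements_commute)

lemma touches_two_agreements:
  assumes "touches c d" "h1 \<in> H" "h2 \<in> H" "h1 \<noteq> h2" "e h1 c = e h1 d" "e h2 c = e h2 d"
  shows "c = d"
  using agreements_ge_2[of h1 h2 c d] assms by (auto simp: touches_def)

text \<open>
  Each column not fixed on the line contributes exactly one agreement with \<open>c\<close>. The total is what
  makes parity arguments possible.
\<close>

lemma sum_agreements_line:
  assumes c: "c \<in> W" and h: "h1 \<in> H" "h2 \<in> H" "h1 \<noteq> h2" and a: "a1 \<in> K" "a2 \<in> K"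
    and off: "a1 \<noteq> e h1 c"
  shows "(\<Sum>d\<in>line h1 a1 h2 a2. agreements c d) = card K - 1 + (if a2 = e h2 c then card K else 0)"
proof -
  let ?L = "line h1 a1 h2 a2"
  have other: "card {d\<in>?L. e h d = e h c} = 1" if "h \<in> H - {h1} - {h2}" for h
    using card_line_at[of h1 h2 h a1 a2 "e h c"] h a that entry c by auto
  have at1: "{d\<in>?L. e h1 d = e h1 c} = {}" using off by (auto simp: line_def)
  have at2: "{d\<in>?L. e h2 d = e h2 c} = (if a2 = e h2 c then ?L else {})" by (auto simp: line_def)
  have "(\<Sum>d\<in>?L. agreements c d) = (\<Sum>h\<in>H. card {d\<in>?L. e h d = e h c})"
    by (rule sum_agreements[OF finite_line])
  also have "\<dots> = card {d\<in>?L. e h1 d = e h1 c} + (card {d\<in>?L. e h2 d = e h2 c}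
      + (\<Sum>h\<in>H - {h1} - {h2}. card {d\<in>?L. e h d = e h c}))"
    using h finite_H by (simp add: sum.remove[OF finite_H h(1)] sum.remove[of "H - {h1}" h2])
  also have "\<dots> = (if a2 = e h2 c then card K else 0) + (card H - 2)"
    unfolding at1 at2 using h finite_H card_line[OF h a] other
    by (auto simp: numeral_2_eq_2)
  finally show ?thesis by (simp add: card_columns)
qed

text \<open>
  The words of this line agree with \<open>c\<close> in one column or in two, and the total number of agreements
  is one less than twice the number of words.
\<close>

lemma tangent_at_point:
  assumes c: "c \<in> W" and h: "h1 \<in> H" "h2 \<in> H" "h1 \<noteq> h2" and a: "a1 \<in> K" and off: "a1 \<noteq> e h1 c"
  shows "\<exists>!d. d \<in> line h1 a1 h2 (e h2 c) \<and> agreements c d = 1"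
proof (rule exactly_one_of_sum)
  let ?L = "line h1 a1 h2 (e h2 c)"
  show "finite ?L" by (rule finite_line)
  have a2: "e h2 c \<in> K" using entry h c by blast
  show "agreements c d = 1 \<or> agreements c d = 2" if d: "d \<in> ?L" for d
  proof -
    have "agreements c d > 0" unfolding agreements_pos using d h(2) by (auto simp: line_def intro!: bexI[of _ h2])
    moreover have "agreements c d \<le> 2"
      using agreements_le_2[of c d] c d off by (auto simp: line_def)
    ultimately show ?thesis by linarith
  qed
  have "card K > 0" using a finite_K card_gt_0_iff by blast
  then show "(\<Sum>d\<in>?L. agreements c d) + 1 = 2 * card ?L"
    using sum_agreements_line[OF c h a a2 off] card_line[OF h a a2] by simp
qed

text \<open>
  If \<open>c\<close> avoids both fixed points of the line, the agreements along the line add up to \<open>q - 1\<close>, an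
  odd number because \<open>q\<close> is even. So some word has an odd number of agreements, namely one.
\<close>

lemma tangent_exists:
  assumes c: "c \<in> W" and h: "h1 \<in> H" "h2 \<in> H" "h1 \<noteq> h2" and a: "a1 \<in> K" "a2 \<in> K"
    and off: "a1 \<noteq> e h1 c"
  shows "\<exists>d \<in> line h1 a1 h2 a2. agreements c d = 1"
proof (cases "a2 = e h2 c")
  case True
  then show ?thesis using tangent_at_point[OF c h a(1) off] by blast
next
  case False
  let ?L = "line h1 a1 h2 a2"
  have "card K > 0" using a finite_K card_gt_0_iff by blast
  then have "odd (\<Sum>d\<in>?L. agreements c d)"
    using sum_agreements_line[OF c h a off] False even_K by simp
  then obtain d where d: "d \<in> ?L" "odd (agreements c d)"
    by (meson dvd_sum)
  then have "agreements c d \<le> 2"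
    using agreements_le_2[of c d] c off by (auto simp: line_def)
  then have "agreements c d = 1" using d(2) by (cases "agreements c d = 0"; cases "agreements c d = 2"; force)
  then show ?thesis using d(1) by blast
qed

text \<open>
  There is one tangent for each of the \<open>q\<close> columns in which it can touch \<open>c\<close>, hence \<open>q\<close> tangents,
  and by \<open>tangent_exists\<close> they cover all \<open>q\<close> letters of the column \<open>h2\<close>. So no letter is taken twice.
\<close>

lemma tangents_through_point:
  assumes c: "c \<in> W" and h: "h1 \<in> H" "h2 \<in> H" "h1 \<noteq> h2" and a: "a1 \<in> K" and off: "a1 \<noteq> e h1 c"
  defines "T \<equiv> {d\<in>W. e h1 d = a1 \<and> agreements c d = 1}"
  shows "bij_betw (e h2) T K"
proof -
  have fin: "finite T" unfolding T_def using finite_W by simp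
  have one: "card {d\<in>T. e h d = e h c} = 1" if h': "h \<in> H - {h1}" for h
  proof -
    obtain d where "d \<in> line h1 a1 h (e h c) \<and> agreements c d = 1"
      and "\<And>d'. d' \<in> line h1 a1 h (e h c) \<and> agreements c d' = 1 \<Longrightarrow> d' = d"
      using tangent_at_point[of c h1 h a1] c h(1) h' a off by (auto elim!: ex1E)
    then have "{d\<in>T. e h d = e h c} = {d}" unfolding T_def line_def by blast
    then show ?thesis by simp
  qed
  have "card T = (\<Sum>d\<in>T. agreements c d)" by (simp add: T_def)
  also have "\<dots> = (\<Sum>h\<in>H. card {d\<in>T. e h d = e h c})" by (rule sum_agreements[OF fin])
  also have "\<dots> = card {d\<in>T. e h1 d = e h1 c} + (\<Sum>h\<in>H - {h1}. card {d\<in>T. e h d = e h c})"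
    by (rule sum.remove[OF finite_H h(1)])
  also have "\<dots> = card K"
  proof -
    have "{d\<in>T. e h1 d = e h1 c} = {}" using off by (auto simp: T_def)
    then have "card {d\<in>T. e h1 d = e h1 c} = 0" by (simp only: card.empty)
    then show ?thesis using one h finite_H by (simp add: card_columns)
  qed
  finally have cT: "card T = card K" .
  have im: "e h2 ` T = K"
  proof
    show "e h2 ` T \<subseteq> K" using entry h by (auto simp: T_def)
    show "K \<subseteq> e h2 ` T"
      using tangent_exists[OF c h a _ off] by (force simp: T_def line_def)
  qed
  then show ?thesis using eq_card_imp_inj_on[OF fin, of "e h2"] cT by (simp add: bij_betw_def)
qed

lemma touching_word_off:
  assumes c: "c \<in> W" and h: "h1 \<in> H" "h2 \<in> H" "h1 \<noteq> h2" and a: "a1 \<in> K" "a2 \<in> K"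
    and off: "a1 \<noteq> e h1 c"
  shows "\<exists>!d. d \<in> line h1 a1 h2 a2 \<and> touches c d"
proof -
  let ?T = "{d\<in>W. e h1 d = a1 \<and> agreements c d = 1}"
  have b: "bij_betw (e h2) ?T K" by (rule tangents_through_point[OF c h a(1) off])
  then obtain d where d: "d \<in> ?T" "e h2 d = a2"
    using a(2) by (auto simp: bij_betw_def image_iff)
  have T: "d' \<in> ?T \<and> e h2 d' = a2 \<longleftrightarrow> d' \<in> line h1 a1 h2 a2 \<and> touches c d'" for d'
    using off by (auto simp: line_def touches_def)
  have "d' = d" if "d' \<in> ?T \<and> e h2 d' = a2" for d'
    using that d b by (auto simp: bij_betw_def inj_on_def)
  then show ?thesis using d T by blast
qed

lemma touching_word:
  assumes c: "c \<in> W" and h: "h1 \<in> H" "h2 \<in> H" "h1 \<noteq> h2" and a: "a1 \<in> K" "a2 \<in> K"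
  shows "\<exists>!d. d \<in> line h1 a1 h2 a2 \<and> touches c d"
proof (cases "a1 = e h1 c")
  case False
  then show ?thesis by (rule touching_word_off[OF assms])
next
  case on: True
  show ?thesis
  proof (cases "a2 = e h2 c")
    case False
    then show ?thesis
      unfolding line_commute[of h1] by (intro touching_word_off) (use assms in auto)
  next
    case True
    show ?thesis
    proof
      show "c \<in> line h1 a1 h2 a2 \<and> touches c c"
        using on True c by (simp add: line_def touches_def)
      show "d = c" if "d \<in> line h1 a1 h2 a2 \<and> touches c d" for d
        using touches_two_agreements[of c d h1 h2] that h on True by (auto simp: line_def)
    qed
  qed
qed

lemma card_touching_on_line:
  assumes "c \<in> W" "h1 \<in> H" "h2 \<in> H" "h1 \<noteq> h2" "a1 \<in> K" "a2 \<in> K"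
  shows "card {d\<in>line h1 a1 h2 a2. touches c d} = 1"
proof -
  obtain d where "d \<in> line h1 a1 h2 a2 \<and> touches c d"
    and "\<And>d'. d' \<in> line h1 a1 h2 a2 \<and> touches c d' \<Longrightarrow> d' = d"
    using touching_word[OF assms] by (auto elim!: ex1E)
  then have "{d\<in>line h1 a1 h2 a2. touches c d} = {d}" by blast
  then show ?thesis by simp
qed

lemma card_touching_through:
  assumes c: "c \<in> W" and h: "h \<in> H" and a: "a \<in> K"
  shows "card {d\<in>W. touches c d \<and> e h d = a} = card K"
proof -
  let ?S = "{d\<in>W. touches c d \<and> e h d = a}"
  have "card {h} < card H" using three_columns by simp
  then obtain h2 where h2: "h2 \<in> H" "h2 \<noteq> h" using obtain_column[of "{h}"] by auto
  have "card ?S = (\<Sum>b\<in>K. card {d\<in>?S. e h2 d = b})"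
    by (rule card_by_value) (use finite_W finite_K entry h2 in auto)
  also have "\<dots> = (\<Sum>b\<in>K. 1)"
  proof (rule sum.cong)
    fix b assume b: "b \<in> K"
    have "{d\<in>?S. e h2 d = b} = {d\<in>line h a h2 b. touches c d}" by (auto simp: line_def)
    then show "card {d\<in>?S. e h2 d = b} = 1"
      using card_touching_on_line[of c h h2 a b] c h a h2 b by simp
  qed simp
  finally show ?thesis by simp
qed

lemma card_touching:
  assumes c: "c \<in> W"
  shows "card {d\<in>W. touches c d} = (card K)\<^sup>2"
proof -
  obtain h where h: "h \<in> H" using three_columns by fastforce
  have "card {d\<in>W. touches c d} = (\<Sum>a\<in>K. card {d\<in>{d\<in>W. touches c d}. e h d = a})"
    by (rule card_by_value) (use finite_W finite_K entry h in auto)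
  also have "\<dots> = (\<Sum>a\<in>K. card K)"
    using card_touching_through[OF c h] by (intro sum.cong) simp_all
  finally show ?thesis by (simp add: power2_eq_square)
qed

text \<open>
  Two different members of the touching class of \<open>c\<close> agree in at most one column, by \<open>touching_word\<close>. Given
  \<open>d\<close> in the class, each of the \<open>q + 1\<close> columns accounts for \<open>q - 1\<close> further members that agree with
  \<open>d\<close> there, which gives \<open>q\<^sup>2 - 1\<close> members. The class has no more, so all of them touch \<open>d\<close>.
\<close>

lemma touches_trans:
  assumes c: "c \<in> W" and d: "d \<in> W" "touches c d" and f: "f \<in> W" "touches c f"
  shows "touches d f"
proof -
  let ?T = "{x\<in>W. touches c x}"
  have fin: "finite ?T" using finite_W by simp
  have dT: "d \<in> ?T" and fT: "f \<in> ?T" using d f by auto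
  have le1: "agreements d x \<le> 1" if x: "x \<in> ?T - {d}" for x
  proof (rule ccontr)
    assume "\<not> agreements d x \<le> 1"
    then have "2 \<le> card {h\<in>H. e h d = e h x}" by (simp add: agreements_def)
    then obtain Z where "Z \<subseteq> {h\<in>H. e h d = e h x}" "card Z = 2"
      by (meson obtain_subset_with_card_n)
    then obtain h1 h2 where h: "h1 \<in> H" "h2 \<in> H" "h1 \<noteq> h2" "e h1 d = e h1 x" "e h2 d = e h2 x"
      by (auto simp: card_2_iff)
    have "\<exists>!y. y \<in> line h1 (e h1 x) h2 (e h2 x) \<and> touches c y"
      by (rule touching_word) (use c h x entry in auto)
    then have "d = x" using x d h by (auto simp: line_def)
    then show False using x by simp
  qed
  have "card H * card K = (\<Sum>h\<in>H. card {x\<in>?T. e h x = e h d})"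
    using card_touching_through[OF c] entry d(1) by (simp add: conj_assoc)
  also have "\<dots> = (\<Sum>x\<in>?T. agreements d x)" by (rule sum_agreements[OF fin, symmetric])
  also have "\<dots> = card H + (\<Sum>x\<in>?T - {d}. agreements d x)"
    by (subst sum.remove[OF fin dT]) (simp add: agreements_self)
  finally have eq: "(\<Sum>x\<in>?T - {d}. agreements d x) = (card K)\<^sup>2 - 1"
    by (simp add: card_columns power2_eq_square algebra_simps)
  show ?thesis
  proof (rule ccontr)
    assume n: "\<not> touches d f"
    then have fd: "f \<in> ?T - {d}" "agreements d f = 0"
      using fT le1[of f] by (auto simp: touches_def)
    have "(\<Sum>x\<in>?T - {d}. agreements d x) = (\<Sum>x\<in>?T - {d} - {f}. agreements d x)"
      using fd fin by (subst sum.remove[of _ f]) auto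
    also have "\<dots> \<le> (\<Sum>x\<in>?T - {d} - {f}. 1)"
      using le1 by (intro sum_mono) auto
    also have "\<dots> = (card K)\<^sup>2 - 2"
      using fd fin dT card_touching[OF c] by simp
    finally have "(card K)\<^sup>2 - 1 \<le> (card K)\<^sup>2 - 2" unfolding eq .
    moreover have "card {d, f} \<le> card ?T" by (rule card_mono[OF fin]) (use dT fT in auto)
    moreover have "card {d, f} = 2" using fd(1) by auto
    ultimately show False using card_touching[OF c] by linarith
  qed
qed

text \<open>
  Every touching class has exactly one representative on a fixed line, and the words of a line are
  distinguished by their letters in a third column. That letter of the representative names the class.
\<close>

lemma touching_classes_form_column:
  obtains t where "maximal_strength_three_array W (insert None (Some ` H)) K (case_option t e)"
    and "\<And>c d. c \<in> W \<Longrightarrow> d \<in> W \<Longrightarrow> t c = t d \<longleftrightarrow> touches c d"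
proof -
  obtain Z where "Z \<subseteq> H" "card Z = 3" using three_columns by (meson obtain_subset_with_card_n)
  then obtain h1 h2 h3 where h: "h1 \<in> H" "h2 \<in> H" "h3 \<in> H" "h1 \<noteq> h2" "h1 \<noteq> h3" "h2 \<noteq> h3"
    by (auto simp: card_3_iff)
  have "card K \<noteq> 0" using three_columns card_columns by simp
  then obtain a where a: "a \<in> K" by fastforce
  let ?L = "line h1 a h2 a"
  define r where "r c = (THE d. d \<in> ?L \<and> touches c d)" for c
  define t where "t c = e h3 (r c)" for c
  have r: "r c \<in> ?L" "touches c (r c)" if "c \<in> W" for c
    using theI'[OF touching_word[OF that h(1,2,4) a a]] by (simp_all add: r_def)
  have r_unique: "d = r c" if "c \<in> W" "d \<in> ?L" "touches c d" for c d
    using touching_word[OF that(1) h(1,2,4) a a] r[OF that(1)] that by blast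
  have LW: "x \<in> W" if "x \<in> ?L" for x using that by (simp add: line_def)
  have b: "bij_betw (e h3) ?L K" by (rule bij_betw_line[OF h a a])
  have tK: "t c \<in> K" if "c \<in> W" for c
    using b r(1)[OF that] by (auto simp: t_def bij_betw_def)
  have t_iff: "t c = t d \<longleftrightarrow> touches c d" if c: "c \<in> W" and d: "d \<in> W" for c d
  proof
    assume "t c = t d"
    then have "r c = r d"
      using b r(1)[OF c] r(1)[OF d] by (auto simp: t_def bij_betw_def inj_on_def)
    then show "touches c d"
      using touches_trans[of "r c" c d] r(2)[OF c] r(2)[OF d] c d LW[OF r(1)[OF c]]
      by (simp add: touches_commute)
  next
    assume "touches c d"
    then have "touches d (r c)"
      using touches_trans[of c d "r c"] c d r[OF c] LW by blast
    then have "r c = r d" using r_unique d r(1)[OF c] by blast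
    then show "t c = t d" by (simp add: t_def)
  qed
  have onto: "\<exists>c0\<in>W. t c0 = b" if "b \<in> K" for b
  proof -
    have "b \<in> e h3 ` ?L" using b that by (simp add: bij_betw_def)
    then obtain d where d: "d \<in> ?L" "e h3 d = b" by blast
    then have "d = r d" using r_unique[of d d] LW by (simp add: touches_def)
    then have "t d = b" using d by (simp add: t_def)
    then show ?thesis using d LW by blast
  qed
  have new: "\<exists>!c. c \<in> W \<and> t c = b \<and> e k1 c = b1 \<and> e k2 c = b2"
    if k: "k1 \<in> H" "k2 \<in> H" "k1 \<noteq> k2" and bK: "b \<in> K" "b1 \<in> K" "b2 \<in> K" for k1 k2 b b1 b2
  proof -
    obtain c0 where c0: "c0 \<in> W" "t c0 = b" using onto bK(1) by blast
    have "c \<in> W \<and> t c = b \<and> e k1 c = b1 \<and> e k2 c = b2 \<longleftrightarrow> c \<in> line k1 b1 k2 b2 \<and> touches c0 c"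
      for c using t_iff[OF c0(1), of c] c0(2) by (auto simp: line_def)
    then show ?thesis using touching_word[OF c0(1) k bK(2,3)] by simp
  qed
  have "maximal_strength_three_array W (insert None (Some ` H)) K (case_option t e)"
  proof
    show "finite W" "finite K" "finite (insert None (Some ` H))"
      using finite_W finite_H finite_K by simp_all
    have cH: "card (insert None (Some ` H)) = card H + 1"
      using finite_H by (simp add: card_image)
    show "card (insert None (Some ` H)) = card K + 2" using cH card_columns by simp
    show "3 \<le> card (insert None (Some ` H))" using cH three_columns by simp
    show "case_option t e h c \<in> K" if "h \<in> insert None (Some ` H)" "c \<in> W" for h c
      using that tK entry by auto
  next
    fix i1 i2 i3 a1 a2 a3
    assume i: "i1 \<in> insert None (Some ` H)" "i2 \<in> insert None (Some ` H)" "i3 \<in> insert None (Some ` H)"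
      "i1 \<noteq> i2" "i1 \<noteq> i3" "i2 \<noteq> i3" and aK: "a1 \<in> K" "a2 \<in> K" "a3 \<in> K"
    let ?e = "case_option t e"
    let ?P = "\<exists>!c. c \<in> W \<and> ?e i1 c = a1 \<and> ?e i2 c = a2 \<and> ?e i3 c = a3"
    consider "i1 = None" | "i2 = None" | "i3 = None" | "i1 \<noteq> None" "i2 \<noteq> None" "i3 \<noteq> None" by blast
    then show ?P
    proof cases
      case 1
      then obtain k2 k3 where "i2 = Some k2" "i3 = Some k3" "k2 \<in> H" "k3 \<in> H" "k2 \<noteq> k3"
        using i by auto
      then show ?thesis using new[of k2 k3 a1 a2 a3] aK 1 by simp
    next
      case 2
      then obtain k1 k3 where "i1 = Some k1" "i3 = Some k3" "k1 \<in> H" "k3 \<in> H" "k1 \<noteq> k3"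
        using i by auto
      then show ?thesis using new[of k1 k3 a2 a1 a3] aK 2 by (simp add: conj_left_commute)
    next
      case 3
      then obtain k1 k2 where "i1 = Some k1" "i2 = Some k2" "k1 \<in> H" "k2 \<in> H" "k1 \<noteq> k2"
        using i by auto
      then show ?thesis using new[of k1 k2 a3 a1 a2] aK 3 by (simp add: conj_ac)
    next
      case 4
      then obtain k1 k2 k3 where "i1 = Some k1" "i2 = Some k2" "i3 = Some k3"
        "k1 \<in> H" "k2 \<in> H" "k3 \<in> H"
        using i by auto
      then show ?thesis using interpolation[of k1 k2 k3 a1 a2 a3] i aK by simp
    qed
  qed
  then show thesis using that t_iff by blast
qed

theorem intersecting_families:
  assumes A: "A \<subseteq> W" and meet: "\<And>c d. c \<in> A \<Longrightarrow> d \<in> A \<Longrightarrow> \<exists>h\<in>H. e h c = e h d" and K: "card K > 3"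
  shows "card A \<le> (card K)\<^sup>2"
    and "card A = (card K)\<^sup>2 \<longleftrightarrow>
      (\<exists>h\<in>H. \<exists>a\<in>K. A = {c\<in>W. e h c = a}) \<or> (\<exists>c\<in>W. A = {d\<in>W. touches c d})"
proof -
  obtain t where ext: "maximal_strength_three_array W (insert None (Some ` H)) K (case_option t e)"
    and t: "\<And>c d. c \<in> W \<Longrightarrow> d \<in> W \<Longrightarrow> t c = t d \<longleftrightarrow> touches c d"
    by (rule touching_classes_form_column) blast
  interpret ext: maximal_strength_three_array W "insert None (Some ` H)" K "case_option t e"
    by (rule ext)
  have meet': "\<exists>i\<in>insert None (Some ` H). case_option t e i c = case_option t e i d"
    if "c \<in> A" "d \<in> A" for c d
    using meet[OF that] by auto
  show "card A \<le> (card K)\<^sup>2" by (rule ext.intersecting_bound[OF A meet']) (use K in auto)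
  show "card A = (card K)\<^sup>2 \<longleftrightarrow>
      (\<exists>h\<in>H. \<exists>a\<in>K. A = {c\<in>W. e h c = a}) \<or> (\<exists>c\<in>W. A = {d\<in>W. touches c d})"
  proof
    assume max: "card A = (card K)\<^sup>2"
    have "\<exists>i\<in>insert None (Some ` H). \<exists>a\<in>K. A = {c\<in>W. case_option t e i c = a}"
      by (rule ext.extremal_is_fibre[OF A meet' max]) (use K in auto)
    then obtain i a where i: "i \<in> insert None (Some ` H)" "a \<in> K"
      "A = {c\<in>W. case_option t e i c = a}"
      by blast
    show "(\<exists>h\<in>H. \<exists>a\<in>K. A = {c\<in>W. e h c = a}) \<or> (\<exists>c\<in>W. A = {d\<in>W. touches c d})"
    proof (cases i)
      case None
      have "A \<noteq> {}" using max K by auto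
      then obtain c where "c \<in> W" "t c = a" using i(3) None by auto
      then have "A = {d\<in>W. touches c d}" using i(3) None t[of c] by (auto simp: eq_commute)
      then show ?thesis using \<open>c \<in> W\<close> by blast
    next
      case (Some h)
      then show ?thesis using i by auto
    qed
  next
    assume "(\<exists>h\<in>H. \<exists>a\<in>K. A = {c\<in>W. e h c = a}) \<or> (\<exists>c\<in>W. A = {d\<in>W. touches c d})"
    then show "card A = (card K)\<^sup>2" using card_fibre card_touching by auto
  qed
qed

end

section \<open>Coordinates for oval cones and ovoidal Laguerre planes\<close>

lemma pg_points_iff:
  fixes U :: "('k::field ^ 'n) set"
  assumes "vec.subspace U"
  shows "X \<in> pg_points U \<longleftrightarrow> (\<exists>v. v \<noteq> 0 \<and> v \<in> U \<and> X = vec.span {v})"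
proof
  assume "X \<in> pg_points U"
  then have X: "vec.subspace X" "vec.dim X = 1" "X \<subseteq> U" by (auto simp: pg_points_def)
  obtain B where B: "B \<subseteq> X" "vec.independent B" "X \<subseteq> vec.span B" "card B = vec.dim X"
    using vec.basis_exists by blast
  then obtain v where v: "B = {v}" using X(2) by (metis card_1_singletonE)
  have "v \<noteq> 0" using B(2) v vec.dependent_zero by blast
  moreover have "X = vec.span {v}"
    using B v X(1) by (metis vec.span_minimal subset_antisym)
  ultimately show "\<exists>v. v \<noteq> 0 \<and> v \<in> U \<and> X = vec.span {v}" using B v X by auto
next
  assume "\<exists>v. v \<noteq> 0 \<and> v \<in> U \<and> X = vec.span {v}"
  then obtain v where v: "v \<noteq> 0" "v \<in> U" "X = vec.span {v}" by blast
  have "vec.independent {v}" using v(1) by simp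
  then have "vec.dim X = 1" using v(3) vec.dim_eq_card_independent[of "{v}"] by simp
  then show "X \<in> pg_points U"
    using v assms by (auto simp: pg_points_def vec.span_minimal)
qed

lemma span_in_pg_points:
  fixes U :: "('k::field ^ 'n) set"
  assumes "vec.subspace U" "v \<noteq> 0"
  shows "vec.span {v} \<in> pg_points U \<longleftrightarrow> v \<in> U"
proof
  assume "vec.span {v} \<in> pg_points U"
  then have "vec.span {v} \<subseteq> U" by (simp add: pg_points_def)
  then show "v \<in> U" using vec.span_base[of v "{v}"] by blast
next
  assume "v \<in> U"
  then show "vec.span {v} \<in> pg_points U"
    unfolding pg_points_iff[OF assms(1)] using assms(2) by blast
qed

lemma span_single_eq:
  fixes v w :: "'k::field ^ 'n"
  assumes "vec.span {v} = vec.span {w}"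
  obtains s where "w = s *s v"
proof -
  have "w \<in> vec.span {v}" unfolding assms by (simp add: vec.span_base)
  then show thesis using that by (auto simp: vec.span_singleton)
qed

lemma pg_join_spans:
  "pg_join (vec.span {r}) (vec.span {p}) = pg_points (vec.span {r, p :: 'k::field ^ 'n})"
proof -
  have "vec.span (vec.span {r} \<union> vec.span {p}) = vec.span {r, p}"
  proof
    show "vec.span (vec.span {r} \<union> vec.span {p}) \<subseteq> vec.span {r, p}"
      by (intro vec.span_minimal Un_least vec.span_mono) auto
    show "vec.span {r, p} \<subseteq> vec.span (vec.span {r} \<union> vec.span {p})"
      by (intro vec.span_mono) (auto simp: vec.span_base)
  qed
  then show ?thesis by (simp only: pg_join_def)
qed

lemma span_single_eqI:
  fixes v w :: "'k::field ^ 'n"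
  assumes "w \<noteq> 0" "w \<in> vec.span {v}"
  shows "vec.span {w} = vec.span {v}"
proof -
  obtain s where s: "w = s *s v" using assms(2) by (auto simp: vec.span_singleton)
  then have "s \<noteq> 0" using assms(1) by auto
  then have "v = inverse s *s w" using s by (simp add: vec.scale_scale)
  then have "v \<in> vec.span {w}" by (auto simp: vec.span_singleton)
  then show ?thesis
    using assms(2) by (intro subset_antisym vec.span_minimal) auto
qed

lemma subspace_scale_cancel:
  fixes v :: "'k::field ^ 'n"
  assumes "vec.subspace U" "s *s v \<in> U" "v \<notin> U"
  shows "s = 0"
proof (rule ccontr)
  assume "s \<noteq> 0"
  then have "v = inverse s *s (s *s v)" by (simp add: vec.scale_scale)
  then show False using vec.subspace_scale[OF assms(1,2), of "inverse s"] assms(3) by simp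
qed

lemma hyperplane_meets_line_once:
  fixes r p :: "'k::field ^ 4"
  assumes U: "vec.subspace U" "vec.dim U = 3" and r: "r \<notin> U"
  shows "\<exists>!t. p + t *s r \<in> U"
proof -
  have spanU: "vec.span U = U" using U(1) by (simp add: vec.span_eq_iff)
  have "r \<notin> vec.span U" unfolding spanU by (rule r)
  then have "vec.dim (insert r U) = 4" using U by (simp add: vec.dim_insert)
  then have "vec.span (insert r U) = UNIV"
    using vec.dim_eq_full[of "insert r U"] vec_dim_card[where 'a='k and 'n=4]
    by (simp add: vec.dimension_def)
  then obtain k where k: "p - k *s r \<in> U"
    using vec.span_breakdown_eq[of p r U] unfolding spanU by auto
  show ?thesis
  proof
    show "p + (- k) *s r \<in> U" using k by simp
    show "t = - k" if "p + t *s r \<in> U" for t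
    proof -
      have "(p + t *s r) - (p - k *s r) = (t + k) *s r" by (simp add: vec.scale_left_distrib)
      then have "(t + k) *s r \<in> U" using vec.subspace_diff[OF U(1) that k] by simp
      then have "t + k = 0" by (rule subspace_scale_cancel[OF U(1) _ r])
      then show ?thesis by (simp add: eq_neg_iff_add_eq_0)
    qed
  qed
qed

text \<open>
  Moving three independent vectors of a subspace without \<open>r\<close> along \<open>r\<close> changes neither their
  independence nor their independence from \<open>r\<close>: with \<open>r\<close> they span the same four-dimensional space.
\<close>

lemma lifted_triple_spans_plane:
  fixes r p1 p2 p3 :: "'k::field ^ 4" and t1 t2 t3 :: 'k
  assumes U: "vec.subspace U" and r: "r \<notin> U" and p: "p1 \<in> U" "p2 \<in> U" "p3 \<in> U"
    and ind: "vec.independent {p1, p2, p3}" "card {p1, p2, p3} = 3"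
  defines "V \<equiv> vec.span {p1 + t1 *s r, p2 + t2 *s r, p3 + t3 *s r}"
  shows "vec.dim V = 3" "r \<notin> V"
proof -
  let ?x = "{p1 + t1 *s r, p2 + t2 *s r, p3 + t3 *s r}"
  have "vec.span {p1, p2, p3} \<subseteq> U" using p U by (intro vec.span_minimal) auto
  then have "r \<notin> vec.span {p1, p2, p3}" using r by blast
  then have "vec.dim (insert r {p1, p2, p3}) = 4"
    using vec.dim_eq_card_independent[OF ind(1)] ind(2) by (simp add: vec.dim_insert)
  moreover have "insert r {p1, p2, p3} \<subseteq> vec.span (insert r ?x)"
  proof -
    have "p \<in> vec.span (insert r ?x)" if "p + t *s r \<in> ?x" for p t
    proof -
      have "p + t *s r \<in> vec.span (insert r ?x)" "r \<in> vec.span (insert r ?x)"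
        using that by (auto intro: vec.span_base)
      then have "(p + t *s r) - t *s r \<in> vec.span (insert r ?x)"
        by (intro vec.span_diff vec.span_scale)
      then show ?thesis by simp
    qed
    then show ?thesis by (auto intro: vec.span_base)
  qed
  ultimately have four: "4 \<le> vec.dim (insert r ?x)"
    by (metis vec.dim_mono)
  have "vec.dim ?x \<le> card ?x" by (rule vec.dim_le_card') simp
  also have "\<dots> \<le> 3" by (simp add: card_insert_if)
  finally have three: "vec.dim ?x \<le> 3" .
  then show "r \<notin> V" using four by (auto simp: vec.dim_insert V_def)
  then show "vec.dim V = 3" using four three by (simp add: vec.dim_insert V_def)
qed

lemma oval_triple_independent:
  assumes oval: "oval_in \<pi> S" and X: "X \<in> S" "Y \<in> S" "Z \<in> S" "X \<noteq> Y" "X \<noteq> Z" "Y \<noteq> Z"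
    and x: "X = vec.span {x}" "x \<noteq> 0" and y: "Y = vec.span {y}" "y \<noteq> 0" and z: "Z = vec.span {z}" "z \<noteq> 0"
  shows "vec.independent {x, y, z}" "card {x, y, z} = 3"
proof -
  have y_x: "y \<notin> vec.span {x}"
    using span_single_eqI[of y x] x y X(4) by auto
  have xy: "vec.independent {x, y}" "x \<noteq> y"
    using y_x x X(4) y by (auto simp: vec.independent_insert insert_commute[of x y])
  have z_xy: "z \<notin> vec.span {x, y}"
  proof
    assume z': "z \<in> vec.span {x, y}"
    have sub: "vec.subspace (vec.span {x, y})" by (rule vec.subspace_span)
    have "vec.dim (vec.span {x, y}) = 2"
      using vec.dim_eq_card_independent[OF xy(1)] xy(2) by simp
    then have "pg_points (vec.span {x, y}) \<in> pg_lines" using sub by (auto simp: pg_lines_def)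
    moreover have "{X, Y, Z} \<subseteq> pg_points (vec.span {x, y})"
      using span_in_pg_points[OF sub] x y z z' by (auto intro: vec.span_base)
    ultimately have "pg_collinear {X, Y, Z}" unfolding pg_collinear_def by blast
    then show False using oval X by (auto simp: oval_in_def)
  qed
  then have "z \<notin> {x, y}" using vec.span_base by blast
  then show "card {x, y, z} = 3" using xy(2) by auto
  have "vec.independent (insert z {x, y})"
    by (rule vec.independent_insertI[OF z_xy xy(1)])
  then show "vec.independent {x, y, z}" by (simp add: insert_commute)
qed

text \<open>
  \<open>g (X, t)\<close> is the point with parameter \<open>t\<close> on the generator \<open>X\<close>. The points
  are arbitrary, so that the coordinates of a cone can be carried to every isomorphic plane.
\<close>

definition coordinatizes :: "('h \<times> 'k \<Rightarrow> 'p) \<Rightarrow> 'h set \<Rightarrow> 'p set \<Rightarrow> 'p set set \<Rightarrow> bool" where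
  "coordinatizes g S P B \<longleftrightarrow> card S = CARD('k) + 1 \<and> bij_betw g (S \<times> UNIV) P \<and>
     (\<forall>c\<in>B. \<forall>X\<in>S. \<exists>!t. g (X, t) \<in> c) \<and>
     (\<forall>X\<in>S. \<forall>Y\<in>S. \<forall>Z\<in>S. X \<noteq> Y \<longrightarrow> X \<noteq> Z \<longrightarrow> Y \<noteq> Z \<longrightarrow>
       (\<forall>a b d. \<exists>!c. c \<in> B \<and> g (X, a) \<in> c \<and> g (Y, b) \<in> c \<and> g (Z, d) \<in> c))"

text \<open>
  Choose a vector \<open>p X\<close> for each point \<open>X\<close> of the oval and a vector \<open>r\<close> for the vertex. The points
  other than the vertex on the generator through \<open>X\<close> are then spanned by the vectors \<open>p X + t *s r\<close>,
  each for one \<open>t\<close>. A plane that avoids the vertex is a complement of \<open>r\<close>, so it picks one \<open>t\<close> for every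
  \<open>X\<close>; and since no three points of the oval are collinear, three points on different generators lie
  in exactly one such plane.
\<close>

lemma cone_coordinates:
  fixes R :: "('k::{field,finite} ^ 4) set"
  assumes "oval_cone R Q"
  shows "\<exists>(S :: ('k ^ 4) set set) (g :: ('k ^ 4) set \<times> 'k \<Rightarrow> ('k ^ 4) set).
    coordinatizes g S (Q - {R}) (cone_circles R Q)"
proof -
  obtain \<pi> S where \<pi>: "\<pi> \<in> pg_planes" and oval: "oval_in \<pi> S" and Rpt: "R \<in> pg_points UNIV"
    and R\<pi>: "R \<notin> \<pi>" and Q: "Q = (\<Union>X\<in>S. pg_join R X)"
    using assms by (auto simp: oval_cone_def)
  obtain U0 where U0: "vec.subspace U0" "\<pi> = pg_points U0"
    using \<pi> by (auto simp: pg_planes_def)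
  obtain r where r: "r \<noteq> 0" "R = vec.span {r}"
    using Rpt pg_points_iff[OF vec.subspace_UNIV] by blast
  have rU0: "r \<notin> U0" using span_in_pg_points[OF U0(1) r(1)] R\<pi> U0(2) r(2) by simp
  have "\<forall>X\<in>S. \<exists>v. v \<noteq> 0 \<and> v \<in> U0 \<and> X = vec.span {v}"
    using oval pg_points_iff[OF U0(1)] U0(2) by (auto simp: oval_in_def)
  then obtain p where "\<forall>X\<in>S. p X \<noteq> 0 \<and> p X \<in> U0 \<and> X = vec.span {p X}"
    by (rule bchoice[THEN exE])
  then have p: "p X \<noteq> 0" "p X \<in> U0" "X = vec.span {p X}" if "X \<in> S" for X
    using that by blast+
  define g where "g = (\<lambda>(X, t). vec.span {p X + t *s r})"
  \<comment> \<open>The oval plane does not contain \<open>r\<close>, so components along \<open>r\<close> can be compared.\<close>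
  have scaled: "p Y = s *s p X \<and> t' = s * t"
    if "X \<in> S" "Y \<in> S" "p Y + t' *s r = s *s (p X + t *s r)" for X Y s t t'
  proof -
    have eq: "p Y - s *s p X = (s * t - t') *s r"
      using that(3) by (simp add: algebra_simps vec.scale_left_diff_distrib vec.scale_right_distrib)
    have "(s * t - t') *s r \<in> U0"
      unfolding eq[symmetric] using that p U0(1) by (intro vec.subspace_diff vec.subspace_scale) auto
    then have "s * t - t' = 0" by (rule subspace_scale_cancel[OF U0(1) _ rU0])
    then show ?thesis using eq by simp
  qed
  have nonzero: "p X + t *s r \<noteq> 0" if "X \<in> S" for X t
    using scaled[of X X t 0 0] p(1)[OF that] that by auto
  have in_plane: "g (X, t) \<in> pg_points U \<longleftrightarrow> p X + t *s r \<in> U" if "X \<in> S" "vec.subspace U" for X t U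
    using span_in_pg_points[OF that(2) nonzero[OF that(1)]] by (simp add: g_def)
  have inj: "inj_on g (S \<times> UNIV)"
  proof (rule inj_onI, clarify)
    fix X t Y t' assume X: "X \<in> S" and Y: "Y \<in> S" and eq: "g (X, t) = g (Y, t')"
    obtain s where s: "p Y + t' *s r = s *s (p X + t *s r)"
      using eq by (auto simp: g_def elim: span_single_eq)
    have st: "p Y = s *s p X" "t' = s * t" using scaled[OF X Y s] by auto
    have "p Y \<in> vec.span {p X}" using st(1) by (auto simp: vec.span_singleton)
    then have XY: "X = Y" using span_single_eqI[of "p Y" "p X"] p X Y by metis
    then have "s = 1" using st(1) p(1)[OF X] by (metis vec.scale_cancel_right vec.scale_one)
    then show "X = Y \<and> t = t'" using XY st(2) by simp
  qed
  have on_join: "g ` ({X} \<times> UNIV) = pg_join R X - {R}" if X: "X \<in> S" for X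
  proof -
    have sub: "vec.subspace (vec.span {r, p X})" by (rule vec.subspace_span)
    have join: "pg_join R X = pg_points (vec.span {r, p X})"
      using pg_join_spans[of r "p X"] r(2) p(3)[OF X] by simp
    show ?thesis
    proof (intro subset_antisym subsetI)
      fix Y assume "Y \<in> g ` ({X} \<times> UNIV)"
      then obtain t where Y: "Y = g (X, t)" by auto
      have "p X + t *s r \<in> vec.span {r, p X}"
        by (intro vec.span_add vec.span_scale) (auto intro: vec.span_base)
      then have "Y \<in> pg_join R X" unfolding join Y using in_plane[OF X sub] by simp
      moreover have "Y \<noteq> R"
      proof
        assume "Y = R"
        then have "vec.span {r} = vec.span {p X + t *s r}" using Y r(2) by (simp add: g_def)
        then obtain s where s: "p X + t *s r = s *s r" by (rule span_single_eq)
        have "p X = (s - t) *s r" using s by (simp add: vec.scale_left_diff_distrib algebra_simps)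
        then have "s - t = 0"
          using subspace_scale_cancel[OF U0(1) _ rU0, of "s - t"] p(2)[OF X] by simp
        then show False using \<open>p X = (s - t) *s r\<close> p(1)[OF X] by simp
      qed
      ultimately show "Y \<in> pg_join R X - {R}" by simp
    next
      fix Y assume Y: "Y \<in> pg_join R X - {R}"
      then obtain v where v: "v \<noteq> 0" "v \<in> vec.span {r, p X}" "Y = vec.span {v}"
        unfolding join using pg_points_iff[OF sub] by blast
      obtain a where "v - a *s r \<in> vec.span {p X}"
        using v(2) vec.span_breakdown_eq[of v r "{p X}"] by auto
      then obtain b where "v - a *s r = b *s p X" by (auto simp: vec.span_singleton)
      then have ab: "v = b *s p X + a *s r" by (simp add: algebra_simps)
      have "b \<noteq> 0"
      proof
        assume "b = 0"
        then have "v \<in> vec.span {r}" using ab by (auto simp: vec.span_singleton)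
        then show False using span_single_eqI[OF v(1)] v(3) r(2) Y by simp
      qed
      then have "v = b *s (p X + (a / b) *s r)"
        using ab by (simp add: vec.scale_right_distrib vec.scale_scale)
      then have "v \<in> vec.span {p X + (a / b) *s r}" by (auto simp: vec.span_singleton)
      then have "Y = g (X, a / b)" using span_single_eqI[OF v(1)] v(3) by (simp add: g_def)
      then show "Y \<in> g ` ({X} \<times> UNIV)" by auto
    qed
  qed
  have "g ` (S \<times> UNIV) = (\<Union>X\<in>S. g ` ({X} \<times> UNIV))" by auto
  also have "\<dots> = Q - {R}" unfolding Q using on_join by auto
  finally have image: "g ` (S \<times> UNIV) = Q - {R}" .
  have gQ: "g (X, t) \<in> Q" if "X \<in> S" for X t using image that by blast
  have circle: "D \<in> cone_circles R Q \<longleftrightarrow>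
      (\<exists>U. vec.subspace U \<and> vec.dim U = 3 \<and> r \<notin> U \<and> D = pg_points U \<inter> Q)" for D
    unfolding cone_circles_def pg_planes_def r(2)
    using span_in_pg_points[OF _ r(1)] by auto
  show ?thesis
    unfolding coordinatizes_def
  proof (intro exI[of _ S] exI[of _ g] conjI ballI impI allI)
    show "card S = CARD('k) + 1" using oval by (simp add: oval_in_def)
    show "bij_betw g (S \<times> UNIV) (Q - {R})" using inj image by (simp add: bij_betw_def)
  next
    fix D X assume D: "D \<in> cone_circles R Q" and X: "X \<in> S"
    obtain U where U: "vec.subspace U" "vec.dim U = 3" "r \<notin> U" "D = pg_points U \<inter> Q"
      using D circle by blast
    have on: "g (X, t) \<in> D \<longleftrightarrow> p X + t *s r \<in> U" for t
      using in_plane[OF X U(1)] gQ[OF X] U(4) by simp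
    show "\<exists>!t. g (X, t) \<in> D"
      unfolding on by (rule hyperplane_meets_line_once[OF U(1-3)])
  next
    fix X Y Z a b c
    assume S: "X \<in> S" "Y \<in> S" "Z \<in> S" "X \<noteq> Y" "X \<noteq> Z" "Y \<noteq> Z"
    let ?B = "{p X + a *s r, p Y + b *s r, p Z + c *s r}"
    let ?V = "vec.span ?B"
    have ind: "vec.independent {p X, p Y, p Z}" "card {p X, p Y, p Z} = 3"
      by (rule oval_triple_independent[OF oval S p(3,1)[OF S(1)] p(3,1)[OF S(2)] p(3,1)[OF S(3)]])+
    have V: "vec.dim ?V = 3" "r \<notin> ?V"
      by (rule lifted_triple_spans_plane[OF U0(1) rU0 p(2)[OF S(1)] p(2)[OF S(2)] p(2)[OF S(3)] ind])+
    have mem: "g (X, a) \<in> pg_points U \<and> g (Y, b) \<in> pg_points U \<and> g (Z, c) \<in> pg_points U \<longleftrightarrow> ?B \<subseteq> U"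
      if "vec.subspace U" for U
      using in_plane[OF _ that] S by simp
    show "\<exists>!D. D \<in> cone_circles R Q \<and> g (X, a) \<in> D \<and> g (Y, b) \<in> D \<and> g (Z, c) \<in> D"
    proof (rule ex1I[of _ "pg_points ?V \<inter> Q"])
      have "pg_points ?V \<inter> Q \<in> cone_circles R Q"
        unfolding circle using V vec.subspace_span by blast
      moreover have "?B \<subseteq> ?V" by (rule vec.span_superset)
      ultimately show "pg_points ?V \<inter> Q \<in> cone_circles R Q \<and> g (X, a) \<in> pg_points ?V \<inter> Q
          \<and> g (Y, b) \<in> pg_points ?V \<inter> Q \<and> g (Z, c) \<in> pg_points ?V \<inter> Q"
        using mem[OF vec.subspace_span, of ?B] gQ S by blast
    next
      fix D assume D: "D \<in> cone_circles R Q \<and> g (X, a) \<in> D \<and> g (Y, b) \<in> D \<and> g (Z, c) \<in> D"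
      then obtain U where U: "vec.subspace U" "vec.dim U = 3" "D = pg_points U \<inter> Q"
        using circle by blast
      then have "?V \<subseteq> U" using D mem[OF U(1)] by (intro vec.span_minimal) auto
      then have "?V = U"
        by (intro vec.subspace_dim_equal vec.subspace_span U(1)) (simp_all only: V(1) U(2))
      then show "D = pg_points ?V \<inter> Q" using U(3) by simp
    qed
  qed
qed

lemma laguerre_coordinates:
  fixes P :: "'p set"
  assumes "ovoidal_laguerre_plane TYPE('k::{field,finite}) P B"
  shows "\<exists>(S :: ('k ^ 4) set set) (g :: ('k ^ 4) set \<times> 'k \<Rightarrow> 'p). coordinatizes g S P B"
proof -
  obtain R :: "('k ^ 4) set" and Q f where BP: "B \<subseteq> Pow P" and cone: "oval_cone R Q"
    and f: "bij_betw f P (Q - {R})" and fB: "(\<lambda>c. f ` c) ` B = cone_circles R Q"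
    using assms unfolding ovoidal_laguerre_plane_def by (elim conjE exE)
  obtain S :: "('k ^ 4) set set" and \<gamma> :: "('k ^ 4) set \<times> 'k \<Rightarrow> ('k ^ 4) set"
    where coord: "coordinatizes \<gamma> S (Q - {R}) (cone_circles R Q)"
    using cone_coordinates[OF cone] by blast
  then have cS: "card S = CARD('k) + 1" and \<gamma>: "bij_betw \<gamma> (S \<times> UNIV) (Q - {R})"
    by (simp_all add: coordinatizes_def)
  have once: "\<exists>!t. \<gamma> (X, t) \<in> D" if "D \<in> cone_circles R Q" "X \<in> S" for D X
    using coord that by (simp add: coordinatizes_def)
  have three: "\<exists>!D. D \<in> cone_circles R Q \<and> \<gamma> (X, a) \<in> D \<and> \<gamma> (Y, b) \<in> D \<and> \<gamma> (Z, d) \<in> D"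
    if "X \<in> S" "Y \<in> S" "Z \<in> S" "X \<noteq> Y" "X \<noteq> Z" "Y \<noteq> Z" for X Y Z a b d
    using coord that by (simp add: coordinatizes_def)
  define g where "g = inv_into P f \<circ> \<gamma>"
  have injf: "inj_on f P" using f by (simp add: bij_betw_def)
  have g: "bij_betw g (S \<times> UNIV) P"
    unfolding g_def by (rule bij_betw_trans[OF \<gamma> bij_betw_inv_into[OF f]])
  have fg: "f (g (X, t)) = \<gamma> (X, t)" if "X \<in> S" for X t
  proof -
    have "\<gamma> (X, t) \<in> f ` P" using \<gamma> f that by (auto simp: bij_betw_def)
    then show ?thesis by (simp add: g_def f_inv_into_f)
  qed
  have gP: "g (X, t) \<in> P" if "X \<in> S" for X t using g that by (auto simp: bij_betw_def)
  have mem: "g (X, t) \<in> c \<longleftrightarrow> \<gamma> (X, t) \<in> f ` c" if "c \<in> B" "X \<in> S" for c X t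
  proof -
    have "c \<subseteq> P" using BP that(1) by blast
    then show ?thesis
      using inj_on_image_mem_iff[OF injf gP[OF that(2)], of c t] fg[OF that(2)] by simp
  qed
  have injB: "inj_on (\<lambda>c. f ` c) B"
    using inj_on_image_Pow[OF injf] BP by (rule inj_on_subset)
  show ?thesis
    unfolding coordinatizes_def
  proof (intro exI[of _ S] exI[of _ g] conjI ballI impI allI cS g)
    fix c X assume c: "c \<in> B" and X: "X \<in> S"
    have "f ` c \<in> cone_circles R Q" unfolding fB[symmetric] using c by (rule imageI)
    then show "\<exists>!t. g (X, t) \<in> c" using once[OF _ X] mem[OF c X] by simp
  next
    fix X Y Z a b d
    assume S: "X \<in> S" "Y \<in> S" "Z \<in> S" "X \<noteq> Y" "X \<noteq> Z" "Y \<noteq> Z"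
    let ?\<Phi> = "\<lambda>D. \<gamma> (X, a) \<in> D \<and> \<gamma> (Y, b) \<in> D \<and> \<gamma> (Z, d) \<in> D"
    have eq: "g (X, a) \<in> c \<and> g (Y, b) \<in> c \<and> g (Z, d) \<in> c \<longleftrightarrow> ?\<Phi> (f ` c)" if "c \<in> B" for c
      using mem[OF that] S by simp
    obtain D where D: "D \<in> cone_circles R Q" "?\<Phi> D"
      and uniq: "\<And>D'. D' \<in> cone_circles R Q \<Longrightarrow> ?\<Phi> D' \<Longrightarrow> D' = D"
      using three[OF S, of a b d] by (elim ex1E) blast
    obtain c where c: "c \<in> B" "D = f ` c" using D(1) unfolding fB[symmetric] by (elim imageE)
    show "\<exists>!c. c \<in> B \<and> g (X, a) \<in> c \<and> g (Y, b) \<in> c \<and> g (Z, d) \<in> c"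
    proof (rule ex1I[of _ c])
      show "c \<in> B \<and> g (X, a) \<in> c \<and> g (Y, b) \<in> c \<and> g (Z, d) \<in> c"
        using eq c D(2) by simp
      fix c' assume c': "c' \<in> B \<and> g (X, a) \<in> c' \<and> g (Y, b) \<in> c' \<and> g (Z, d) \<in> c'"
      then have "f ` c' \<in> cone_circles R Q" unfolding fB[symmetric] by (intro imageI) (elim conjE)
      moreover have "?\<Phi> (f ` c')" using c' eq[of c'] by simp
      ultimately have "f ` c' = f ` c" unfolding c(2)[symmetric] by (rule uniq)
      then show "c' = c" using inj_onD[OF injB] c' c(1) by simp
    qed
  qed
qed

section \<open>Intersecting families of circles\<close>

theorem theorem1p5:
  fixes P :: "'p set" and B F :: "'p set set" and q :: nat
  assumes "CARD('k::{field,finite}) = q"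
    and "even q" and "q > 2"
    and "ovoidal_laguerre_plane TYPE('k) P B"
    and "F \<subseteq> B" and "intersecting_family F"
  shows "card F \<le> q\<^sup>2 \<and>
    (card F = q\<^sup>2 \<longleftrightarrow>
      (\<exists>X\<in>P. F = {c \<in> B. X \<in> c}) \<or>
      (\<exists>c\<in>B. F = {c} \<union> {c' \<in> B. card (c \<inter> c') = 1}))"
proof -
  obtain S :: "('k ^ 4) set set" and g :: "('k ^ 4) set \<times> 'k \<Rightarrow> 'p"
    where coord: "coordinatizes g S P B"
    using laguerre_coordinates[OF assms(4)] by blast
  then have cS: "card S = CARD('k) + 1" and g: "bij_betw g (S \<times> UNIV) P"
    by (simp_all add: coordinatizes_def)
  have once: "\<exists>!t. g (X, t) \<in> c" if "c \<in> B" "X \<in> S" for c X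
    using coord that by (simp add: coordinatizes_def)
  have three: "\<exists>!c. c \<in> B \<and> g (X, a) \<in> c \<and> g (Y, b) \<in> c \<and> g (Z, d) \<in> c"
    if "X \<in> S" "Y \<in> S" "Z \<in> S" "X \<noteq> Y" "X \<noteq> Z" "Y \<noteq> Z" for X Y Z a b d
    using coord that by (simp add: coordinatizes_def)
  define e where "e X c = (THE t. g (X, t) \<in> c)" for X c
  have e: "g (X, t) \<in> c \<longleftrightarrow> e X c = t" if "c \<in> B" "X \<in> S" for c X t
    using theI'[OF once[OF that]] the1_equality[OF once[OF that], of t] unfolding e_def by auto
  have finS: "finite S" using cS card_ge_0_finite[of S] by simp
  have BP: "B \<subseteq> Pow P" using assms(4) unfolding ovoidal_laguerre_plane_def by blast
  have "finite P" using bij_betw_finite[OF g] finS by simp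
  then have finB: "finite B" using BP finite_subset by blast
  have inj: "inj_on g (S \<times> UNIV)" and onto: "g ` (S \<times> UNIV) = P"
    using g by (simp_all add: bij_betw_def)
  interpret even_laguerre_array B S "UNIV :: 'k set" e
  proof
    show "finite B" "finite S" "finite (UNIV :: 'k set)" using finB finS by simp_all
    show "3 \<le> card S" using cS assms(1,3) by simp
    show "card S = CARD('k) + 1" by (rule cS)
    show "even CARD('k)" using assms(1,2) by simp
    show "e X c \<in> UNIV" for X c by simp
    show "\<exists>!c. c \<in> B \<and> e X c = a \<and> e Y c = b \<and> e Z c = d"
      if "X \<in> S" "Y \<in> S" "Z \<in> S" "X \<noteq> Y" "X \<noteq> Z" "Y \<noteq> Z" for X Y Z a b d
    proof -
      have "c \<in> B \<and> e X c = a \<and> e Y c = b \<and> e Z c = d \<longleftrightarrow>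
          c \<in> B \<and> g (X, a) \<in> c \<and> g (Y, b) \<in> c \<and> g (Z, d) \<in> c" for c
        using that by (cases "c \<in> B") (simp_all add: e)
      then show ?thesis using three[OF that, of a b d] by (simp only:)
    qed
  qed
  \<comment> \<open>Common points of circles correspond to columns in which the words agree.\<close>
  have inter: "c \<inter> d = (\<lambda>X. g (X, e X c)) ` {X\<in>S. e X c = e X d}" if c: "c \<in> B" and d: "d \<in> B" for c d
  proof (intro subset_antisym subsetI)
    fix x assume x: "x \<in> c \<inter> d"
    then have "x \<in> g ` (S \<times> UNIV)" using BP c onto by blast
    then obtain X t where X: "X \<in> S" "x = g (X, t)" by blast
    then have "e X c = t" "e X d = t" using x e c d by blast+
    then show "x \<in> (\<lambda>X. g (X, e X c)) ` {X\<in>S. e X c = e X d}"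
      using X by (intro image_eqI[of _ _ X]) simp_all
  next
    fix x assume "x \<in> (\<lambda>X. g (X, e X c)) ` {X\<in>S. e X c = e X d}"
    then show "x \<in> c \<inter> d" using e c d by auto
  qed
  have card_inter: "card (c \<inter> d) = agreements c d" if "c \<in> B" "d \<in> B" for c d
    unfolding inter[OF that] agreements_def
    by (rule card_image) (auto intro!: inj_onI dest: inj_onD[OF inj])
  have meet: "\<exists>X\<in>S. e X c = e X d" if "c \<in> F" "d \<in> F" for c d
  proof (cases "c = d")
    case True
    moreover have "S \<noteq> {}" using cS by auto
    ultimately show ?thesis by auto
  next
    case False
    then have "c \<inter> d \<noteq> {}"
      using assms(6) that by (auto simp: intersecting_family_def pairwise_def)
    then show ?thesis using inter[of c d] that assms(5) by auto
  qed
  have K: "CARD('k) > 3"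
  proof -
    have "q \<noteq> 3" using assms(2) by auto
    then show ?thesis using assms(1,3) by simp
  qed
  \<comment> \<open>The two kinds of extremal families of words are the two kinds of families of circles.\<close>
  have pencils: "(\<exists>X\<in>S. \<exists>a\<in>UNIV. F = {c\<in>B. e X c = a}) \<longleftrightarrow> (\<exists>x\<in>P. F = {c\<in>B. x \<in> c})"
  proof -
    have "{c\<in>B. e X c = a} = {c\<in>B. g (X, a) \<in> c}" if "X \<in> S" for X a using e that by auto
    then show ?thesis unfolding onto[symmetric] by auto
  qed
  have tangents: "{d\<in>B. touches c d} = {c} \<union> {c'\<in>B. card (c \<inter> c') = 1}" if "c \<in> B" for c
    using that card_inter[OF that] by (auto simp: touches_def)
  show ?thesis
    using intersecting_families[OF assms(5) meet K] pencils tangents assms(1) by auto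
qed

end
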